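(* Let $X$ be an asymptotic $\ell_1$ space. Then $$\sup\{D(Y):Y\prec X\}\ge\sup\{\gamma_1^{-1}:\gamma\in\Delta(X)\}.$$
   Context: Spaces and subspaces are (closed) separable infinite-dimensional Banach spaces. For a basic sequence $(x_i)$, $(y_i)\prec(x_i)$ means that $(y_i)$ is a (finite or infinite) block basis of $(x_i)$; for $X$ with a basis $(e_i)$, $Y\prec X$ means $Y=[y_i]$ (closed linear span) for some infinite block basis $(y_i)\prec(e_i)$. Supports are w.r.t. the indicated basic sequence, and $x<y$ means $\max\operatorname{supp}x<\min\operatorname{supp}y$. A space $X$ with a basis $(e_i)$ is asymptotic $\ell_1$ (w.r.t. $(e_i)$) if there is $C$ such that for all $n$ and all finitely supported $e_n\le x_1<\dots<x_n$ (i.e. $n\le\min\operatorname{supp}x_1$), $\|\sum_1^nx_i\|\ge(1/C)\sum_1^n\|x_i\|$. For an equivalent norm $|\cdot|$ on $(Y,\|\cdot\|)$, $d(Y,|\cdot|)=\inf_Z\sup\{|x|/|y|:x,y\in Z,\ \|x\|=\|y\|=1\}$, the infimum over all infinite-dimensional subspaces $Z$ of $Y$. The distortion constant of $Y$ is $D(Y)=\sup d(Y,|\cdot|)$ over all equivalent norms $|\cdot|$ on $Y$. For finite $F,G\subseteq\mathbb N$, $F<G$ means $\max F<\min G$ (or one is empty); $F\ge n$ means $\min F\ge n$. Schreier classes: for sets $\mathcal F,\mathcal G$ of finite subsets of $\mathbb N$, $\mathcal F[\mathcal G]=\{\bigcup_1^nG_i: n\in\mathbb N, G_1<\dots<G_n,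 G_i\in\mathcal G, (\min G_i)_1^n\in\mathcal F\}$. $\mathcal S_0=\{\{n\}:n\in\mathbb N\}\cup\{\emptyset\}$, $\mathcal S_1=\{F:\min F\ge|F|\}\cup\{\emptyset\}$, $\mathcal S_{\alpha+1}=\mathcal S_1[\mathcal S_\alpha]$, and for a limit ordinal $\alpha<\omega_1$ one fixes $\alpha_n\uparrow\alpha$ and sets $\mathcal S_\alpha=\{F:\text{for some }n,\ F\in\mathcal S_{\alpha_n}\text{ and }F\ge n\}$. A finite block sequence $(y_i)_1^k\prec(x_i)$ is $\alpha$-admissible w.r.t. $(x_i)$ if $(\min\operatorname{supp}(y_i))_{i=1}^k\in\mathcal S_\alpha$. $\delta_\alpha(x_i)$ is the supremum of $\delta\ge0$ such that $\|\sum_1^ky_i\|\ge\delta\sum_1^k\|y_i\|$ for all $(y_i)_1^k\prec(x_i)$ $\alpha$-admissible w.r.t. $(x_i)$. A basic sequence $(x_i)$ $\Delta$-stabilizes $\gamma=(\gamma_\alpha)_{\alpha<\omega_1}\subseteq\mathbb R$ if there exist $\varepsilon_n\downarrow0$ so that for every $\alpha<\omega_1$ there is $m\in\mathbb N$ such that for all $n\ge m$, if $(y_i)\prec(x_i)_n^\infty$ then $|\delta_\alpha(y_i)-\gamma_\alpha|<\varepsilon_n$. $\Delta(X)$ is the set of all $\gamma$ that are $\Delta$-stabilized by some block basis of the basis of $X$. *)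

theory Defs
  imports "HOL-Analysis.Analysis" "HOL-Library.Countable_Set_Type"
begin

section \<open>The countable ordinals\<close>

text \<open>\<open>cardSuc natLeq\<close> is an initial well-order of cardinality \<open>\<aleph>\<^sub>1\<close>, so its field, ordered
  by it, is (a copy of) \<open>\<omega>\<^sub>1\<close>; the elements of the type \<open>omega1\<close> are the ordinals \<open>\<alpha> < \<omega>\<^sub>1\<close>.
  See \<open>countable_lessThan_omega1\<close> and \<open>uncountable_UNIV_omega1\<close>, which characterise \<open>\<omega>\<^sub>1\<close>
  among well-orders.\<close>

lemma Card_order_omega1: "Card_order (cardSuc natLeq)"
  by (intro cardSuc_Card_order natLeq_Card_order)

lemma Well_order_omega1: "Well_order (cardSuc natLeq)"
  by (intro cardSuc_Well_order natLeq_Card_order)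

lemma infinite_Field_omega1: "infinite (Field (cardSuc natLeq))"
  using cardSuc_finite[OF natLeq_Card_order] by (simp add: Field_natLeq)

typedef omega1 = "Field (cardSuc natLeq)"
  using infinite_Field_omega1 by (metis ex_in_conv finite.emptyI)

instantiation omega1 :: wellorder
begin

definition less_eq_omega1 :: "omega1 \<Rightarrow> omega1 \<Rightarrow> bool" where
  "\<alpha> \<le> \<beta> \<longleftrightarrow> (Rep_omega1 \<alpha>, Rep_omega1 \<beta>) \<in> cardSuc natLeq"

definition less_omega1 :: "omega1 \<Rightarrow> omega1 \<Rightarrow> bool" where
  "\<alpha> < \<beta> \<longleftrightarrow> \<alpha> \<le> \<beta> \<and> \<not> \<beta> \<le> (\<alpha>::omega1)"

instance
proof
  let ?r = "cardSuc natLeq"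
  have wo: "well_order_on (Field ?r) ?r"
    by (rule Well_order_omega1)
  have refl: "refl_on (Field ?r) ?r" and tr: "trans ?r" and anti: "antisym ?r"
    and tot: "total_on (Field ?r) ?r" and wf: "wf (?r - Id)"
    using wo by (auto simp: order_on_defs)
  fix \<alpha> \<beta> \<gamma> :: omega1
  show "(\<alpha> < \<beta>) = (\<alpha> \<le> \<beta> \<and> \<not> \<beta> \<le> \<alpha>)"
    by (rule less_omega1_def)
  show refl': "\<alpha> \<le> \<alpha>" for \<alpha> :: omega1
    using refl Rep_omega1 unfolding less_eq_omega1_def refl_on_def by blast
  show "\<alpha> \<le> \<gamma>" if "\<alpha> \<le> \<beta>" "\<beta> \<le> \<gamma>"
    using that tr unfolding less_eq_omega1_def trans_def by blast
  show anti': "\<alpha> = \<beta>" if "\<alpha> \<le> \<beta>" "\<beta> \<le> \<alpha>" for \<alpha> \<beta> :: omega1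
    using that anti unfolding less_eq_omega1_def antisym_def by (metis Rep_omega1_inject)
  show "\<alpha> \<le> \<beta> \<or> \<beta> \<le> \<alpha>"
    using tot refl' Rep_omega1 unfolding less_eq_omega1_def total_on_def by metis
  have "{(\<alpha>::omega1, \<beta>). \<alpha> < \<beta>} = inv_image (?r - Id) Rep_omega1"
    using anti' refl' unfolding inv_image_def
    by (auto simp: less_omega1_def less_eq_omega1_def Rep_omega1_inject)
  then have "wf {(\<alpha>::omega1, \<beta>). \<alpha> < \<beta>}"
    using wf by simp
  then show "P \<alpha>" if "\<And>\<alpha>. (\<And>\<beta>. \<beta> < \<alpha> \<Longrightarrow> P \<beta>) \<Longrightarrow> P \<alpha>" for P and \<alpha> :: omega1
    using that by (metis (no_types, lifting) case_prodI mem_Collect_eq wf_induct_rule)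
qed

end

lemma countable_lessThan_omega1:
  includes cardinal_syntax
  shows "countable {..<\<alpha>::omega1}"
proof -
  let ?r = "cardSuc natLeq"
  have "Rep_omega1 ` {..<\<alpha>} \<subseteq> underS ?r (Rep_omega1 \<alpha>)"
    by (auto simp: underS_def less_le Rep_omega1_inject less_eq_omega1_def)
  moreover have "|underS ?r (Rep_omega1 \<alpha>)| <o ?r"
    by (rule card_of_underS[OF Card_order_omega1 Rep_omega1])
  then have "|underS ?r (Rep_omega1 \<alpha>)| \<le>o natLeq"
    using cardSuc_ordLeq_ordLess[OF natLeq_Card_order card_of_Card_order] by blast
  then have "countable (underS ?r (Rep_omega1 \<alpha>))"
    by (simp add: countable_card_le_natLeq)
  ultimately show ?thesis
    by (meson Rep_omega1_inject countable_image_inj_on countable_subset inj_onI)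
qed

lemma uncountable_UNIV_omega1:
  includes cardinal_syntax
  shows "uncountable (UNIV :: omega1 set)"
proof
  assume "countable (UNIV :: omega1 set)"
  then have "countable (range Rep_omega1)"
    by simp
  then have "countable (Field (cardSuc natLeq))"
    by (metis type_definition.Rep_range type_definition_omega1)
  then have "|Field (cardSuc natLeq)| \<le>o natLeq"
    by (simp add: countable_card_le_natLeq)
  moreover have "|Field (cardSuc natLeq)| =o cardSuc natLeq"
    by (rule card_of_Field_ordIso[OF Card_order_omega1])
  ultimately have "cardSuc natLeq \<le>o natLeq"
    using ordIso_ordLeq_trans ordIso_symmetric by blast
  then show False
    using cardSuc_greater[OF natLeq_Card_order] not_ordLess_ordLeq by blast
qed

lemma omega1_ex_greater: "\<exists>\<beta>. \<alpha> < (\<beta>::omega1)"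
proof (rule ccontr)
  assume "\<not> ?thesis"
  then have "UNIV = insert \<alpha> {..<\<alpha>}"
    by (auto simp: not_less le_less)
  then show False
    using countable_lessThan_omega1 uncountable_UNIV_omega1 by (metis countable_insert)
qed

definition osuc :: "omega1 \<Rightarrow> omega1" where
  "osuc \<alpha> = (LEAST \<beta>. \<alpha> < \<beta>)"

instantiation omega1 :: "{zero, one}"
begin

definition zero_omega1 :: omega1 where
  "0 = (LEAST \<alpha>::omega1. True)"

definition one_omega1 :: omega1 where
  "1 = osuc 0"

instance ..

end

definition is_limit :: "omega1 \<Rightarrow> bool" where
  "is_limit \<alpha> \<longleftrightarrow> \<alpha> \<noteq> 0 \<and> (\<forall>\<beta>. \<alpha> \<noteq> osuc \<beta>)"

lemma less_osuc: "\<alpha> < osuc \<alpha>"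
  unfolding osuc_def by (rule LeastI_ex) (rule omega1_ex_greater)

lemma osuc_le: "\<alpha> < \<beta> \<Longrightarrow> osuc \<alpha> \<le> \<beta>"
  unfolding osuc_def by (rule Least_le)

lemma osuc_inject: "osuc \<alpha> = osuc \<beta> \<longleftrightarrow> \<alpha> = \<beta>"
  by (metis less_osuc osuc_le linorder_neqE not_less)

lemma zero_le_omega1: "(0::omega1) \<le> \<alpha>"
  unfolding zero_omega1_def by (rule Least_le) simp

lemma osuc_neq_zero: "osuc \<alpha> \<noteq> 0"
  by (metis less_osuc zero_le_omega1 not_less)


section \<open>Schreier classes\<close>

text \<open>Throughout, \<open>\<nat> = {1, 2, \<dots>}\<close>: sequences are functions on \<^typ>\<open>nat\<close> whose terms are those of
  index \<open>\<ge> 1\<close>, and the value at \<open>0\<close> is irrelevant.\<close>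

definition schreier_conv :: "nat set set \<Rightarrow> nat set set \<Rightarrow> nat set set" where
  "schreier_conv \<F> \<G> = {\<Union>i\<in>{1..n}. G i | n (G :: nat \<Rightarrow> nat set).
     (\<forall>i\<in>{1..n}. G i \<in> \<G> \<and> finite (G i) \<and> G i \<noteq> {}) \<and>
     (\<forall>i\<in>{1..n}. \<forall>j\<in>{1..n}. i < j \<longrightarrow> Max (G i) < Min (G j)) \<and>
     (\<lambda>i. Min (G i)) ` {1..n} \<in> \<F>}"

definition schreier0 :: "nat set set" where
  "schreier0 = {{n} | n. 1 \<le> n} \<union> {{}}"

definition schreier1 :: "nat set set" where
  "schreier1 = {F. finite F \<and> F \<noteq> {} \<and> F \<subseteq> {1..} \<and> card F \<le> Min F} \<union> {{}}"

text \<open>\<open>A \<alpha>\<close> is the chosen sequence \<open>\<alpha>\<^sub>n \<up> \<alpha>\<close> at a limit ordinal \<open>\<alpha>\<close>.\<close>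

definition ladder_system :: "(omega1 \<Rightarrow> nat \<Rightarrow> omega1) \<Rightarrow> bool" where
  "ladder_system A \<longleftrightarrow> (\<forall>\<alpha>. is_limit \<alpha> \<longrightarrow>
     (\<forall>n\<ge>1. A \<alpha> n < \<alpha>) \<and>
     (\<forall>m n. 1 \<le> m \<longrightarrow> m \<le> n \<longrightarrow> A \<alpha> m \<le> A \<alpha> n) \<and>
     (\<forall>\<beta><\<alpha>. \<exists>n\<ge>1. \<beta> < A \<alpha> n))"

text \<open>The conjunct \<open>A \<alpha> n < \<alpha>\<close> only serves termination; it holds for every ladder system
  (see \<open>schreier_limit\<close>). Starting the successor case at \<open>0\<close> yields \<open>S\<^sub>1[S\<^sub>0] = S\<^sub>1\<close>
  (see \<open>schreier_one\<close>).\<close>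

declare conj_cong [fundef_cong]

function schreier :: "(omega1 \<Rightarrow> nat \<Rightarrow> omega1) \<Rightarrow> omega1 \<Rightarrow> nat set set" where
  "schreier A \<alpha> =
     (if \<alpha> = 0 then schreier0
      else if \<exists>\<beta>. \<alpha> = osuc \<beta> then schreier_conv schreier1 (schreier A (THE \<beta>. \<alpha> = osuc \<beta>))
      else {F. \<exists>n\<ge>1. A \<alpha> n < \<alpha> \<and> F \<in> schreier A (A \<alpha> n) \<and> (\<forall>i\<in>F. n \<le> i)})"
  by auto
termination
proof (relation "inv_image {(\<alpha>, \<beta>). \<alpha> < \<beta>} snd")
  show "wf (inv_image {(\<alpha>, \<beta>::omega1). \<alpha> < \<beta>} snd)"
    by (rule wf_inv_image) (rule wellorder_class.wf)
next
  fix A :: "omega1 \<Rightarrow> nat \<Rightarrow> omega1" and \<alpha> :: omega1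
  assume "\<exists>\<beta>. \<alpha> = osuc \<beta>"
  then obtain \<beta> where "\<alpha> = osuc \<beta>" by blast
  moreover from this have "(THE \<beta>. \<alpha> = osuc \<beta>) = \<beta>"
    by (simp add: osuc_inject)
  ultimately show "((A, THE \<beta>. \<alpha> = osuc \<beta>), A, \<alpha>) \<in> inv_image {(\<alpha>, \<beta>). \<alpha> < \<beta>} snd"
    by (simp add: less_osuc)
qed simp

declare conj_cong [fundef_cong del]

declare schreier.simps [simp del]

lemma schreier_zero: "schreier A 0 = schreier0"
  by (subst schreier.simps) simp

lemma schreier_osuc: "schreier A (osuc \<alpha>) = schreier_conv schreier1 (schreier A \<alpha>)"
  by (subst schreier.simps) (simp add: osuc_neq_zero osuc_inject)

lemma schreier_limit:
  assumes "ladder_system A" "is_limit \<alpha>"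
  shows "schreier A \<alpha> = {F. \<exists>n\<ge>1. F \<in> schreier A (A \<alpha> n) \<and> (\<forall>i\<in>F. n \<le> i)}"
  using assms by (subst schreier.simps) (auto simp: is_limit_def ladder_system_def)

lemma schreier_one: "schreier A 1 = schreier1"
proof -
  have "schreier_conv schreier1 schreier0 = schreier1"
  proof (intro equalityI subsetI)
    fix F assume "F \<in> schreier_conv schreier1 schreier0"
    then obtain n and G :: "nat \<Rightarrow> nat set" where F: "F = (\<Union>i\<in>{1..n}. G i)"
      and G: "\<forall>i\<in>{1..n}. G i \<in> schreier0 \<and> finite (G i) \<and> G i \<noteq> {}"
      and "\<forall>i\<in>{1..n}. \<forall>j\<in>{1..n}. i < j \<longrightarrow> Max (G i) < Min (G j)"
      and M: "(\<lambda>i. Min (G i)) ` {1..n} \<in> schreier1"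
      unfolding schreier_conv_def mem_Collect_eq by blast
    have "G i = {Min (G i)}" if "i \<in> {1..n}" for i
    proof -
      have "G i \<in> schreier0" "G i \<noteq> {}"
        using G that by auto
      then obtain m where "G i = {m}"
        unfolding schreier0_def by auto
      then show ?thesis by simp
    qed
    then have "F = (\<Union>i\<in>{1..n}. {Min (G i)})"
      unfolding F by (rule SUP_cong[OF refl])
    then have "F = (\<lambda>i. Min (G i)) ` {1..n}"
      by (simp add: UNION_singleton_eq_range)
    then show "F \<in> schreier1"
      using M by simp
  next
    fix F :: "nat set" assume F: "F \<in> schreier1"
    then have fin: "finite F" and pos: "F \<subseteq> {1..}"
      unfolding schreier1_def by auto
    define n where "n = card F"
    define g where "g i = sorted_list_of_set F ! (i - 1)" for i
    have img: "g ` {1..n} = F"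
    proof -
      have "g ` {1..n} = (\<lambda>i. sorted_list_of_set F ! i) ` (\<lambda>i. i - 1) ` {1..n}"
        by (simp add: g_def image_image)
      also have "(\<lambda>i::nat. i - 1) ` {1..n} = {..<n}"
      proof (intro equalityI subsetI)
        fix j assume "j \<in> {..<n}"
        then have "j = Suc j - 1" "Suc j \<in> {1..n}" by auto
        then show "j \<in> (\<lambda>i. i - 1) ` {1..n}" by (rule image_eqI)
      qed auto
      also have "(\<lambda>i. sorted_list_of_set F ! i) ` {..<n} = set (sorted_list_of_set F)"
        by (auto simp: set_conv_nth n_def)
      finally show ?thesis
        using fin by simp
    qed
    have mono: "g i < g j" if "i \<in> {1..n}" "j \<in> {1..n}" "i < j" for i j
      unfolding g_def using that
      by (intro sorted_wrt_nth_less[OF strict_sorted_list_of_set[of F]]) (auto simp: n_def)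
    have "F = (\<Union>i\<in>{1..n}. {g i})"
      using img by blast
    moreover have "\<forall>i\<in>{1..n}. {g i} \<in> schreier0 \<and> finite {g i} \<and> {g i} \<noteq> {}"
      using img pos unfolding schreier0_def by force
    moreover have "\<forall>i\<in>{1..n}. \<forall>j\<in>{1..n}. i < j \<longrightarrow> Max {g i} < Min {g j}"
      using mono by simp
    moreover have "(\<lambda>i. Min {g i}) ` {1..n} \<in> schreier1"
      using img F by simp
    ultimately show "F \<in> schreier_conv schreier1 schreier0"
      unfolding schreier_conv_def mem_Collect_eq
      by - (rule exI[of _ n], rule exI[of _ "\<lambda>i. {g i}"], intro conjI; assumption)
  qed
  then show ?thesis
    by (simp add: one_omega1_def schreier_osuc schreier_zero)
qed


section \<open>Bases and block bases\<close>

definition closed_span :: "(nat \<Rightarrow> 'a::real_normed_vector) \<Rightarrow> 'a set" where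
  "closed_span x = closure (span (x ` {1..}))"

definition is_expansion :: "(nat \<Rightarrow> 'a::real_normed_vector) \<Rightarrow> 'a \<Rightarrow> (nat \<Rightarrow> real) \<Rightarrow> bool" where
  "is_expansion x v a \<longleftrightarrow> a 0 = 0 \<and> (\<lambda>n. \<Sum>i=1..n. a i *\<^sub>R x i) \<longlonglongrightarrow> v"

definition schauder_basis :: "(nat \<Rightarrow> 'a::real_normed_vector) \<Rightarrow> 'a set \<Rightarrow> bool" where
  "schauder_basis x Y \<longleftrightarrow> (\<forall>i\<ge>1. x i \<in> Y) \<and> (\<forall>v\<in>Y. \<exists>!a. is_expansion x v a)"

definition basic_sequence :: "(nat \<Rightarrow> 'a::real_normed_vector) \<Rightarrow> bool" where
  "basic_sequence x \<longleftrightarrow> schauder_basis x (closed_span x)"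

definition supp :: "(nat \<Rightarrow> 'a::real_normed_vector) \<Rightarrow> 'a \<Rightarrow> nat set" where
  "supp x v = {i. (THE a. is_expansion x v a) i \<noteq> 0}"

text \<open>\<open>(y\<^sub>i)\<^sub>i\<^sub>\<in>\<^sub>I\<close> consists of nonzero vectors of finite support with respect to \<open>x\<close>, and
  \<open>y\<^sub>i < y\<^sub>j\<close> for \<open>i < j\<close>.\<close>

definition blocks_on :: "nat set \<Rightarrow> (nat \<Rightarrow> 'a::real_normed_vector) \<Rightarrow> (nat \<Rightarrow> 'a) \<Rightarrow> bool" where
  "blocks_on I x y \<longleftrightarrow>
     (\<forall>i\<in>I. y i \<in> span (x ` {1..}) \<and> y i \<noteq> 0) \<and>
     (\<forall>i\<in>I. \<forall>j\<in>I. i < j \<longrightarrow> Max (supp x (y i)) < Min (supp x (y j)))"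

definition finite_block_sequence ::
    "(nat \<Rightarrow> 'a::real_normed_vector) \<Rightarrow> nat \<Rightarrow> (nat \<Rightarrow> 'a) \<Rightarrow> bool" where
  "finite_block_sequence x k y \<longleftrightarrow> blocks_on {1..k} x y"

definition block_basis :: "(nat \<Rightarrow> 'a::real_normed_vector) \<Rightarrow> (nat \<Rightarrow> 'a) \<Rightarrow> bool" where
  "block_basis x y \<longleftrightarrow> blocks_on {1..} x y"

definition block_subspace :: "(nat \<Rightarrow> 'a::real_normed_vector) \<Rightarrow> 'a set \<Rightarrow> bool" where
  "block_subspace e Y \<longleftrightarrow> (\<exists>y. block_basis e y \<and> Y = closed_span y)"

text \<open>The tail \<open>(x\<^sub>i)\<^sub>i\<^sub>\<ge>\<^sub>n\<close>, for \<open>n \<ge> 1\<close>, reindexed to start at \<open>1\<close>.\<close>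

definition tail_seq :: "nat \<Rightarrow> (nat \<Rightarrow> 'a) \<Rightarrow> nat \<Rightarrow> 'a" where
  "tail_seq n x i = x (n + i - 1)"

definition asymptotic_l1 :: "(nat \<Rightarrow> 'a::real_normed_vector) \<Rightarrow> bool" where
  "asymptotic_l1 e \<longleftrightarrow> (\<exists>C>0. \<forall>n\<ge>1. \<forall>x. finite_block_sequence e n x \<and> n \<le> Min (supp e (x 1)) \<longrightarrow>
     norm (\<Sum>i=1..n. x i) \<ge> (1 / C) * (\<Sum>i=1..n. norm (x i)))"


section \<open>Distortion\<close>

definition inf_dim_subspace :: "'a::real_normed_vector set \<Rightarrow> bool" where
  "inf_dim_subspace Z \<longleftrightarrow> subspace Z \<and> closed Z \<and> (\<nexists>B. finite B \<and> Z \<subseteq> span B)"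

definition equivalent_norm_on :: "'a::real_normed_vector set \<Rightarrow> ('a \<Rightarrow> real) \<Rightarrow> bool" where
  "equivalent_norm_on Y N \<longleftrightarrow>
     (\<forall>x\<in>Y. 0 \<le> N x) \<and> (\<forall>x\<in>Y. N x = 0 \<longleftrightarrow> x = 0) \<and>
     (\<forall>x\<in>Y. \<forall>c. N (c *\<^sub>R x) = \<bar>c\<bar> * N x) \<and>
     (\<forall>x\<in>Y. \<forall>y\<in>Y. N (x + y) \<le> N x + N y) \<and>
     (\<exists>a>0. \<exists>b>0. \<forall>x\<in>Y. a * norm x \<le> N x \<and> N x \<le> b * norm x)"

definition norm_distortion :: "'a::real_normed_vector set \<Rightarrow> ('a \<Rightarrow> real) \<Rightarrow> ereal" where
  "norm_distortion Y N = (INF Z \<in> {Z. inf_dim_subspace Z \<and> Z \<subseteq> Y}.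
     Sup {ereal (N x / N y) | x y. x \<in> Z \<and> y \<in> Z \<and> norm x = 1 \<and> norm y = 1})"

definition distortion_constant :: "'a::real_normed_vector set \<Rightarrow> ereal" where
  "distortion_constant Y = (SUP N \<in> {N. equivalent_norm_on Y N}. norm_distortion Y N)"


section \<open>Stabilization\<close>

definition admissible_blocks ::
    "(omega1 \<Rightarrow> nat \<Rightarrow> omega1) \<Rightarrow> omega1 \<Rightarrow> (nat \<Rightarrow> 'a::real_normed_vector) \<Rightarrow>
      nat \<Rightarrow> (nat \<Rightarrow> 'a) \<Rightarrow> bool" where
  "admissible_blocks A \<alpha> x k y \<longleftrightarrow>
     finite_block_sequence x k y \<and> (\<lambda>i. Min (supp x (y i))) ` {1..k} \<in> schreier A \<alpha>"

text \<open>The set below contains \<open>0\<close> and, for a basic sequence \<open>x\<close> and a ladder system \<open>A\<close>, is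
  bounded above by \<open>1\<close>, since one-term block sequences \<open>(y\<^sub>1)\<close> are \<open>\<alpha>\<close>-admissible; so the real
  supremum is the intended one.\<close>

definition delta ::
    "(omega1 \<Rightarrow> nat \<Rightarrow> omega1) \<Rightarrow> omega1 \<Rightarrow> (nat \<Rightarrow> 'a::real_normed_vector) \<Rightarrow> real" where
  "delta A \<alpha> x = Sup {d. 0 \<le> d \<and> (\<forall>k y. admissible_blocks A \<alpha> x k y \<longrightarrow>
     norm (\<Sum>i=1..k. y i) \<ge> d * (\<Sum>i=1..k. norm (y i)))}"

definition Delta_stabilizes ::
    "(omega1 \<Rightarrow> nat \<Rightarrow> omega1) \<Rightarrow> (nat \<Rightarrow> 'a::real_normed_vector) \<Rightarrow> (omega1 \<Rightarrow> real) \<Rightarrow> bool" where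
  "Delta_stabilizes A x \<gamma> \<longleftrightarrow> basic_sequence x \<and>
     (\<exists>\<epsilon>::nat \<Rightarrow> real. decseq \<epsilon> \<and> \<epsilon> \<longlonglongrightarrow> 0 \<and>
       (\<forall>\<alpha>. \<exists>m\<ge>1. \<forall>n\<ge>m. \<forall>y. block_basis (tail_seq n x) y \<longrightarrow> \<bar>delta A \<alpha> y - \<gamma> \<alpha>\<bar> < \<epsilon> n))"

definition Delta_set ::
    "(omega1 \<Rightarrow> nat \<Rightarrow> omega1) \<Rightarrow> (nat \<Rightarrow> 'a::real_normed_vector) \<Rightarrow> (omega1 \<Rightarrow> real) set" where
  "Delta_set A e = {\<gamma>. \<exists>x. block_basis e x \<and> Delta_stabilizes A x \<gamma>}"

end

theory Submission
  imports Defs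
begin

text \<open>Fix \<open>\<gamma> \<in> \<Delta>(X)\<close>, stabilized by \<open>x\<close>, let \<open>\<theta> > \<gamma>\<^sub>1\<close>, and let \<open>b\<close> be a far enough tail of \<open>x\<close>. If for
  every \<open>n\<close> every block subspace of \<open>b\<close> could be refined so that \<open>\<theta> \<Sum>\<parallel>z\<^sub>i\<parallel> \<le> \<parallel>\<Sum>z\<^sub>i\<parallel>\<close> for all
  \<open>n\<close>-tuples of successive blocks, a diagonal block sequence \<open>w\<close> would have \<open>\<delta>\<^sub>1(w) \<ge> \<theta>\<close>, contradicting
  the choice of \<open>x\<close>. So there are \<open>n\<close> and a block subspace \<open>Y\<close> all of whose block subspaces contain
  successive \<open>z\<^sub>1, \<dots>, z\<^sub>n\<close> with \<open>\<parallel>\<Sum>z\<^sub>i\<parallel> < \<theta> \<Sum>\<parallel>z\<^sub>i\<parallel>\<close>. The norm \<open>|v| = sup \<Sum>\<^sub>j \<parallel>E\<^sub>j v\<parallel>\<close>, the supremum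
  over \<open>n\<close> successive intervals \<open>E\<^sub>1 < \<dots> < E\<^sub>n\<close>, distorts \<open>Y\<close> by \<open>1 / \<theta>\<close>: on \<open>v = \<Sum>z\<^sub>i\<close> one has
  \<open>|v| > \<parallel>v\<parallel> / \<theta>\<close>, while on sums of very many blocks that are almost isometric to the \<open>\<ell>\<^sub>1\<close> basis,
  which every block subspace contains by James' argument, \<open>|u|\<close> and \<open>\<parallel>u\<parallel>\<close> almost agree.

  The basis constant needed to make \<open>|\<cdot>|\<close> an equivalent norm comes for free: for two blocks supported
  beyond \<open>2\<close>, the asymptotic \<open>\<ell>\<^sub>1\<close> inequality bounds the first block by the sum.\<close>

section \<open>Expansions and supports\<close>

text \<open>Coefficients are indexed by positions, not by vectors, so \<open>y\<close> may have
  repetitions; they vanish off \<open>F\<close> so that \<open>c\<close> can itself serve as an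
  expansion.\<close>

lemma span_image_explicit:
  fixes y :: "nat \<Rightarrow> 'a::real_vector"
  assumes "v \<in> span (y ` A)"
  obtains c F where "finite F" "F \<subseteq> A" "v = (\<Sum>i\<in>F. c i *\<^sub>R y i)" "\<And>i. i \<notin> F \<Longrightarrow> c i = 0"
proof -
  have "\<exists>c F. finite F \<and> F \<subseteq> A \<and> v = (\<Sum>i\<in>F. c i *\<^sub>R y i) \<and> (\<forall>i. i \<notin> F \<longrightarrow> c i = 0)"
    using assms
  proof (induction rule: span_induct_alt)
    case base
    show ?case by (intro exI[of _ "\<lambda>_. 0"] exI[of _ "{}"]) simp
  next
    case (step a u v)
    then obtain k c F where k: "k \<in> A" "u = y k" and F: "finite F" "F \<subseteq> A"
      "v = (\<Sum>i\<in>F. c i *\<^sub>R y i)" "\<forall>i. i \<notin> F \<longrightarrow> c i = 0" by auto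
    let ?c = "\<lambda>i. c i + (if i = k then a else 0)"
    have "(\<Sum>i\<in>insert k F. c i *\<^sub>R y i) = v"
      unfolding F(3) by (rule sum.mono_neutral_right) (use F(1,4) in auto)
    moreover have "(\<Sum>i\<in>insert k F. (if i = k then a else 0) *\<^sub>R y i) = a *\<^sub>R y k"
      using F(1) by (simp add: if_distrib[of "\<lambda>r. r *\<^sub>R _"] cong: if_cong)
    ultimately have "a *\<^sub>R u + v = (\<Sum>i\<in>insert k F. ?c i *\<^sub>R y i)"
      by (simp add: scaleR_add_left sum.distrib k)
    moreover have "\<forall>i. i \<notin> insert k F \<longrightarrow> ?c i = 0" using F(4) by auto
    ultimately show ?case using F(1,2) k(1)
      by (intro exI[of _ ?c] exI[of _ "insert k F"]) auto
  qed
  then show ?thesis using that by blast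
qed

lemma span_image_mono: "v \<in> span (b ` A) \<Longrightarrow> A \<subseteq> B \<Longrightarrow> v \<in> span (b ` B)"
  using span_mono[OF image_mono] by blast

lemma is_expansion_finite:
  fixes y :: "nat \<Rightarrow> 'a::real_normed_vector"
  assumes "finite F" "F \<subseteq> {0<..}" "\<And>i. i \<notin> F \<Longrightarrow> c i = 0"
  shows "is_expansion y (\<Sum>i\<in>F. c i *\<^sub>R y i) c"
  unfolding is_expansion_def
proof
  show "c 0 = 0" by (rule assms(3)) (use assms(2) in auto)
  have "(\<Sum>i=1..n. c i *\<^sub>R y i) = (\<Sum>i\<in>F. c i *\<^sub>R y i)" if "n \<ge> Max F" for n
  proof (rule sum.mono_neutral_right)
    show "F \<subseteq> {1..n}"
    proof
      fix i assume "i \<in> F"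
      with assms(2) Max_ge[OF assms(1)] that show "i \<in> {1..n}" by fastforce
    qed
    show "\<forall>i\<in>{1..n} - F. c i *\<^sub>R y i = 0" using assms(3) by simp
  qed simp
  then show "(\<lambda>n. \<Sum>i=1..n. c i *\<^sub>R y i) \<longlonglongrightarrow> (\<Sum>i\<in>F. c i *\<^sub>R y i)"
    by (intro tendsto_eventually eventually_sequentiallyI)
qed

text \<open>Uniqueness alone makes \<open>supp\<close> meaningful on finite combinations; it holds
  for \<open>e\<close> and for every sequence with a basis constant.\<close>

definition unique_expansions :: "(nat \<Rightarrow> 'a::real_normed_vector) \<Rightarrow> bool" where
  "unique_expansions y \<longleftrightarrow> (\<forall>v a a'. is_expansion y v a \<longrightarrow> is_expansion y v a' \<longrightarrow> a = a')"

text \<open>Uniqueness identifies the expansion chosen in \<open>supp\<close> with the coefficients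
  of an explicit finite combination.\<close>

lemma supp_span:
  assumes "unique_expansions y" "v \<in> span (y ` A)" "A \<subseteq> {0<..}"
  shows "supp y v \<subseteq> A" "finite (supp y v)" "v \<in> span (y ` supp y v)"
proof -
  obtain c F where F: "finite F" "F \<subseteq> A" "v = (\<Sum>i\<in>F. c i *\<^sub>R y i)" "\<And>i. i \<notin> F \<Longrightarrow> c i = 0"
    using span_image_explicit[OF assms(2)] by metis
  have "is_expansion y v c"
    unfolding F(3) by (rule is_expansion_finite) (use F(1,2,4) assms(3) in auto)
  then have "(THE a. is_expansion y v a) = c"
    using assms(1) unfolding unique_expansions_def by blast
  then have s: "supp y v = {i. c i \<noteq> 0}"
    by (simp add: supp_def)
  show "supp y v \<subseteq> A" "finite (supp y v)"
    using F finite_subset[OF _ F(1), of "{i. c i \<noteq> 0}"] unfolding s by auto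
  have "v = (\<Sum>i\<in>{i. c i \<noteq> 0}. c i *\<^sub>R y i)"
    unfolding F(3) by (rule sum.mono_neutral_right) (use F(1,4) in auto)
  also have "\<dots> \<in> span (y ` {i. c i \<noteq> 0})"
    by (intro span_sum span_scale span_base) auto
  finally show "v \<in> span (y ` supp y v)" unfolding s .
qed

lemma supp_nonempty:
  assumes "unique_expansions y" "v \<in> span (y ` {0<..})" "v \<noteq> 0"
  shows "supp y v \<noteq> {}"
  using supp_span(3)[OF assms(1,2)] assms(3) by force

lemma supp_greaterThanAtMost:
  assumes "unique_expansions y" "v \<in> span (y ` {s<..t})" "v \<noteq> 0"
  shows "s < Min (supp y v)" "Max (supp y v) \<le> t"
proof -
  have sub: "{s<..t} \<subseteq> {0<..}" by auto
  have "v \<in> span (y ` {0<..})"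
    using assms(2) sub by (rule span_image_mono)
  from supp_nonempty[OF assms(1) this assms(3)]
  have ne: "supp y v \<noteq> {}" .
  note s = supp_span(1,2)[OF assms(1,2) sub]
  show "s < Min (supp y v)" using Min_in[OF s(2) ne] s(1) by auto
  show "Max (supp y v) \<le> t" using Max_in[OF s(2) ne] s(1) by auto
qed

lemma span_supp:
  assumes "unique_expansions y" "v \<in> span (y ` {0<..})" "v \<noteq> 0" "s < Min (supp y v)" "Max (supp y v) \<le> t"
  shows "v \<in> span (y ` {s<..t})"
proof -
  note f = supp_span(2)[OF assms(1,2) order_refl]
  have "supp y v \<subseteq> {s<..t}"
  proof
    fix i assume i: "i \<in> supp y v"
    show "i \<in> {s<..t}" using Min_le[OF f i] Max_ge[OF f i] assms(4,5) by simp
  qed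
  with supp_span(3)[OF assms(1,2) order_refl] show ?thesis by (rule span_image_mono)
qed

lemma atLeast_one_eq: "{1::nat..} = {0<..}"
  by auto

lemma blocks_onI:
  assumes "unique_expansions x" "\<And>i. i \<in> I \<Longrightarrow> y i \<in> span (x ` {p (i - 1)<..p i})"
    "\<And>i. i \<in> I \<Longrightarrow> y i \<noteq> 0" "mono p" "0 \<notin> I"
  shows "blocks_on I x y"
  unfolding blocks_on_def atLeast_one_eq
proof (intro conjI ballI impI)
  fix i assume i: "i \<in> I"
  show "y i \<in> span (x ` {0<..})"
    by (rule span_image_mono[OF assms(2)[OF i]]) auto
  show "y i \<noteq> 0" using assms i by blast
  fix j assume j: "j \<in> I" "i < j"
  have "Max (supp x (y i)) \<le> p i"
    using supp_greaterThanAtMost(2) assms i by blast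
  also have "p i \<le> p (j - 1)" using assms(4) j by (intro monoD[OF assms(4)]) auto
  also have "p (j - 1) < Min (supp x (y j))"
    using supp_greaterThanAtMost(1) assms j by blast
  finally show "Max (supp x (y i)) < Min (supp x (y j))" .
qed

lemma block_basisI:
  assumes "unique_expansions x" "mono p" "\<And>i. 0 < i \<Longrightarrow> y i \<in> span (x ` {p (i - 1)<..p i})"
    "\<And>i. 0 < i \<Longrightarrow> y i \<noteq> 0"
  shows "block_basis x y"
  unfolding block_basis_def by (rule blocks_onI[where p = p]) (use assms in auto)

lemma block_basisE:
  assumes "unique_expansions x" "block_basis x y"
  obtains p where "strict_mono p" "p 0 = 0" "\<And>i. 0 < i \<Longrightarrow> y i \<in> span (x ` {p (i - 1)<..p i})"
proof -
  \<comment> \<open>The breakpoints are the last support indices; the value 0 at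
    \<open>i = 0\<close> lets the first interval start at index 1.\<close>
  define p where "p i = (if i = 0 then 0 else Max (supp x (y i)))" for i :: nat
  have y: "y i \<in> span (x ` {0<..})" "y i \<noteq> 0" if "0 < i" for i
    using assms(2) that unfolding block_basis_def blocks_on_def atLeast_one_eq by auto
  have f: "finite (supp x (y i))" "supp x (y i) \<noteq> {}" "supp x (y i) \<subseteq> {0<..}" if "0 < i" for i
    using supp_span[OF assms(1) y(1)] supp_nonempty[OF assms(1) y] that by auto
  have less: "p (i - 1) < Min (supp x (y i))" if "0 < i" for i
  proof (cases "i = 1")
    case True
    then show ?thesis using f[OF that] by (auto simp: p_def)
  next
    case False
    then show ?thesis
      using assms(2) that unfolding block_basis_def blocks_on_def p_def by simp
  qed
  have "p i < p (Suc i)" for i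
    using less[of "Suc i"] f[of "Suc i"] by (auto simp: p_def intro: less_le_trans)
  then have "strict_mono p" by (simp add: strict_mono_Suc_iff)
  moreover have "y i \<in> span (x ` {p (i - 1)<..p i})" if "0 < i" for i
    using span_supp[OF assms(1) y(1) y(2) less] that by (simp add: p_def)
  ultimately show ?thesis using that by (simp add: p_def)
qed

section \<open>Sums of successive blocks\<close>

text \<open>\<open>blk b U k s t v T\<close>: \<open>v\<close> is the sum of \<open>k\<close> successive, possibly zero, blocks in \<open>U\<close> that are
  supported in \<open>(s, t]\<close> with respect to \<open>b\<close>, and \<open>T\<close> is the sum of their norms.\<close>

inductive blk :: "(nat \<Rightarrow> 'a::real_normed_vector) \<Rightarrow> 'a set \<Rightarrow> nat \<Rightarrow> nat \<Rightarrow> nat \<Rightarrow> 'a \<Rightarrow> real \<Rightarrow> bool"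
  for b U where
  blk_0: "s \<le> t \<Longrightarrow> blk b U 0 s t 0 0"
| blk_Suc: "blk b U k s t v T \<Longrightarrow> t \<le> t' \<Longrightarrow> z \<in> U \<Longrightarrow> z \<in> span (b ` {t<..t'}) \<Longrightarrow>
    blk b U (Suc k) s t' (v + z) (T + norm z)"

lemma blk_le: "blk b U k s t v T \<Longrightarrow> s \<le> t"
  by (induction rule: blk.induct) auto

text \<open>Zero blocks can pad a tuple, so the count may grow as soon as
  \<open>0 \<in> U'\<close>.\<close>

lemma blk_mono:
  assumes "blk b U k s t v T" "U \<subseteq> U'" "s' \<le> s" "k \<le> k'" "0 \<in> U' \<or> k = k'"
  shows "blk b U' k' s' t v T"
proof -
  have *: "blk b U' k s' t v T"
    using assms(1) using assms(2,3) by (induction rule: blk.induct) (auto intro: blk.intros)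
  have "0 \<in> U' \<Longrightarrow> blk b U' (k + j) s' t v T" for j
  proof (induction j)
    case (Suc j)
    then have "blk b U' (Suc (k + j)) s' t (v + 0) (T + norm (0::'a))"
      by (intro blk_Suc) (auto simp: span_zero)
    then show ?case by simp
  qed (use * in auto)
  from this[of "k' - k"] show ?thesis using assms(4,5) * by auto
qed

lemma blk_append:
  assumes "blk b U k s t v T" "blk b U l t' r w T'" "t \<le> t'"
  shows "blk b U (k + l) s r (v + w) (T + T')"
  using assms(2,3)
proof (induction rule: blk.induct)
  \<comment> \<open>Even an empty second tuple moves the right end to \<open>r\<close>, so the
    interval of the last block has to be enlarged.\<close>
  case (blk_0 t' r)
  have "blk b U k s r v T" using assms(1)
  proof (cases rule: blk.cases)
    case (blk_Suc k u v T z)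
    moreover have "span (b ` {u<..t}) \<subseteq> span (b ` {u<..r})"
      using blk_0 assms(3) by (intro span_mono image_mono) auto
    ultimately show ?thesis
      using blk_0 assms(3) by (auto intro!: blk.blk_Suc[of b U _ s u v T r z])
  qed (use blk_0 assms(3) in \<open>auto intro: blk.intros\<close>)
  then show ?case by simp
next
  case (blk_Suc l t' r w T' r' z)
  then show ?case
    using blk.blk_Suc[of b U "k + l" s r "v + w" "T + T'" r' z] by (simp add: add.assoc)
qed

lemma blk_single:
  "z \<in> U \<Longrightarrow> z \<in> span (b ` {s<..t}) \<Longrightarrow> s \<le> t \<Longrightarrow> blk b U 1 s t z (norm z)"
  using blk_Suc[OF blk_0[of s s b U], of t z] by simp

lemma blk_scale:
  assumes "blk b U k s t v T" "\<And>z. z \<in> U \<Longrightarrow> c *\<^sub>R z \<in> U'"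
  shows "blk b U' k s t (c *\<^sub>R v) (\<bar>c\<bar> * T)"
  using assms(1)
proof (induction rule: blk.induct)
  case (blk_Suc k s t v T t' z)
  then show ?case
    using blk.blk_Suc[of b U' k s t "c *\<^sub>R v" "\<bar>c\<bar> * T" t' "c *\<^sub>R z"] assms(2)
    by (simp add: scaleR_add_right distrib_left span_scale)
qed (auto intro: blk.intros)

lemma blk_span:
  assumes "blk b U k s t v T"
  shows "v \<in> span (b ` {s<..t})"
  using assms
proof (induction rule: blk.induct)
  case (blk_Suc k s t v T t' z)
  have "span (b ` {s<..t}) \<subseteq> span (b ` {s<..t'})" "span (b ` {t<..t'}) \<subseteq> span (b ` {s<..t'})"
    using blk_Suc(2) blk_le[OF blk_Suc(1)] by (intro span_mono image_mono; auto)+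
  then show ?case using blk_Suc by (auto intro: span_add)
qed (simp add: span_zero)

lemma blk_in:
  assumes "blk b U k s t v T" "subspace V" "U \<subseteq> V"
  shows "v \<in> V"
  using assms(1) by (induction rule: blk.induct) (use assms(2,3) in \<open>auto intro: subspace_0 subspace_add\<close>)

text \<open>Breakpoints turn intervals with respect to \<open>b\<close> into intervals with respect
  to \<open>e\<close>. Membership in \<open>U'\<close> is asked only on the tail span beyond
  \<open>s\<close>, because the diagonal argument controls only such vectors.\<close>

lemma blk_change_basis:
  assumes "blk b U k s t v T" "mono p"
    and "\<And>i. s < i \<Longrightarrow> b i \<in> span (e ` {p (i - 1)<..p i})"
    and "span (b ` {s<..}) \<inter> U \<subseteq> U'"
  shows "blk e U' k (p s) (p t) v T"
  using assms(1,3,4)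
proof (induction rule: blk.induct)
  case (blk_0 s t)
  then show ?case using monoD[OF assms(2)] by (auto intro: blk.intros)
next
  case (blk_Suc k s t v T t' z)
  have "s \<le> t" using blk_le blk_Suc by blast
  have "b i \<in> span (e ` {p t<..p t'})" if "i \<in> {t<..t'}" for i
  proof -
    have "t \<le> i - 1" using that by auto
    then have "{p (i - 1)<..p i} \<subseteq> {p t<..p t'}"
      using monoD[OF assms(2), of t "i - 1"] monoD[OF assms(2), of i t'] that by auto
    moreover have "b i \<in> span (e ` {p (i - 1)<..p i})"
      using that \<open>s \<le> t\<close> by (intro blk_Suc.prems(1)) auto
    ultimately show ?thesis by (rule span_image_mono[rotated])
  qed
  then have "span (b ` {t<..t'}) \<subseteq> span (e ` {p t<..p t'})"
    by (intro span_minimal) auto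
  moreover have "z \<in> span (b ` {s<..})"
    by (rule span_image_mono[OF blk_Suc.hyps(4)]) (use \<open>s \<le> t\<close> in auto)
  then have "z \<in> U'"
    using blk_Suc.hyps(3) blk_Suc.prems(2) by blast
  ultimately show ?case
    using blk_Suc monoD[OF assms(2)] by (intro blk.blk_Suc) auto
qed

lemma blk_function:
  assumes "\<And>j. j \<in> {1..k} \<Longrightarrow> y j \<in> span (b ` {p (j - 1)<..p j})"
    "\<And>j. j \<in> {1..k} \<Longrightarrow> y j \<in> U" "\<And>j. j \<in> {1..k} \<Longrightarrow> p (j - 1) \<le> p j"
  shows "blk b U k (p 0) (p k) (\<Sum>j=1..k. y j) (\<Sum>j=1..k. norm (y j))"
  using assms
proof (induction k)
  case (Suc k)
  then have "blk b U k (p 0) (p k) (\<Sum>j=1..k. y j) (\<Sum>j=1..k. norm (y j))" by simp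
  then show ?case
    using blk_Suc[of b U k "p 0" "p k" _ _ "p (Suc k)" "y (Suc k)"] Suc.prems(1,2,3)[of "Suc k"] by simp
qed (auto intro: blk.intros)

text \<open>The block sequences of \<open>finite_block_sequence\<close> have nonzero terms, so zero
  blocks must be dropped, which can only lower the count. The second alternative catches tuples in
  which every block vanishes.\<close>

lemma blk_nonzero_function:
  assumes "blk b U k s t v T"
  obtains l y p where "l \<le> k" "mono p" "p 0 = s" "p l = t"
    "\<And>j. j \<in> {1..l} \<Longrightarrow> y j \<in> span (b ` {p (j - 1)<..p j}) \<and> y j \<noteq> 0"
    "v = (\<Sum>j=1..l. y j)" "T = (\<Sum>j=1..l. norm (y j))" | "v = 0" "T = 0"
proof -
  have "(v = 0 \<and> T = 0) \<or> (\<exists>l y p. l \<le> k \<and> mono p \<and> p 0 = s \<and> p l = t \<and>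
    (\<forall>j \<in> {1..l}. y j \<in> span (b ` {p (j - 1)<..p j}) \<and> y j \<noteq> 0) \<and>
    v = (\<Sum>j=1..l. y j) \<and> T = (\<Sum>j=1..l. norm (y j)))"
    using assms
  proof (induction rule: blk.induct)
    case (blk_Suc k s t v T t' z)
    have st: "s \<le> t" using blk_Suc blk_le by blast
    show ?case
    proof (cases "v = 0 \<and> T = 0")
      case v: True
      show ?thesis
      proof (cases "z = 0")
        case False
        define p where "p i = (if i = 0 then s else t')" for i :: nat
        have "mono p" unfolding mono_def p_def using st blk_Suc by auto
        moreover have "z \<in> span (b ` {s<..t'})"
          by (rule span_image_mono[OF blk_Suc(4)]) (use st in auto)
        moreover have "p 0 = s" "p 1 = t'" by (auto simp: p_def)
        ultimately show ?thesis
          using v False by (intro disjI2 exI[of _ 1] exI[of _ "\<lambda>_. z"] exI[of _ p]) auto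
      qed (use v in auto)
    next
      case False
      then obtain l y p where l: "l \<le> k" "mono p" "p 0 = s" "p l = t"
        "\<And>j. j \<in> {1..l} \<Longrightarrow> y j \<in> span (b ` {p (j - 1)<..p j}) \<and> y j \<noteq> 0"
        "v = (\<Sum>j=1..l. y j)" "T = (\<Sum>j=1..l. norm (y j))" using blk_Suc by blast
      show ?thesis
      proof (cases "z = 0")
        case True
        \<comment> \<open>The zero block is dropped and the last interval is stretched to
          \<open>t'\<close>; as \<open>l \<noteq> 0\<close>, the left end \<open>s\<close> is not
          disturbed.\<close>
        define q where "q i = (if i < l then p i else t')" for i
        have "p i \<le> t" if "i < l" for i using monoD[OF l(2), of i l] that l by simp
        then have "mono q" using monoD[OF l(2)] blk_Suc(2) unfolding mono_def q_def
          by (auto intro: order_trans)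
        have "y j \<in> span (b ` {q (j - 1)<..q j}) \<and> y j \<noteq> 0" if "j \<in> {1..l}" for j
        proof -
          have "{p (j - 1)<..p j} \<subseteq> {q (j - 1)<..q j}"
            using that l(4) blk_Suc(2) by (auto simp: q_def)
          then show ?thesis using l(5)[OF that] span_image_mono by blast
        qed
        moreover have "l \<noteq> 0" using False l(6,7) by (cases l) auto
        then have "q 0 = s" "q l = t'" using l(3) by (auto simp: q_def)
        ultimately show ?thesis using l \<open>mono q\<close> True
          by (intro disjI2 exI[of _ l] exI[of _ y] exI[of _ q]) simp
      next
        case nz: False
        define q where "q i = (if i \<le> l then p i else t')" for i
        have "p i \<le> t" if "i \<le> l" for i using monoD[OF l(2) that] l by simp
        then have "mono q" using monoD[OF l(2)] blk_Suc(2) unfolding mono_def q_def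
          by (auto intro: order_trans)
        define y' where "y' j = (if j \<le> l then y j else z)" for j
        have "y' j \<in> span (b ` {q (j - 1)<..q j}) \<and> y' j \<noteq> 0" if "j \<in> {1..Suc l}" for j
          using l(5)[of j] that l(4) blk_Suc(4) nz
          by (cases "j \<le> l") (auto simp: q_def y'_def le_Suc_eq)
        moreover have "(\<Sum>j=1..Suc l. y' j) = v + z" "(\<Sum>j=1..Suc l. norm (y' j)) = T + norm z"
          using l by (auto simp: y'_def)
        moreover have "q 0 = s" "q (Suc l) = t'" "Suc l \<le> Suc k" using l(1,3) by (auto simp: q_def)
        ultimately show ?thesis using \<open>mono q\<close>
          by (intro disjI2 exI[of _ "Suc l"] exI[of _ y'] exI[of _ q]) simp
      qed
    qed
  qed auto
  then show ?thesis using that by blast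
qed

section \<open>Basis constants\<close>

lemma span_tail_bounded:
  fixes b :: "nat \<Rightarrow> 'a::real_vector"
  assumes "v \<in> span (b ` {s<..})"
  obtains t where "s \<le> t" "v \<in> span (b ` {s<..t})"
proof -
  obtain c F where F: "finite F" "F \<subseteq> {s<..}" "v = (\<Sum>i\<in>F. c i *\<^sub>R b i)"
    using span_image_explicit[OF assms] by metis
  have "F \<subseteq> {s<..max s (Max (insert s F))}"
    using F Max_ge[of "insert s F"] by (auto simp: le_max_iff_disj)
  then have "v \<in> span (b ` {s<..max s (Max (insert s F))})"
    unfolding F(3) by (intro span_sum span_scale span_base imageI) auto
  then show ?thesis using that by (meson max.cobounded1)
qed

lemma span_split_at:
  fixes b :: "nat \<Rightarrow> 'a::real_vector"
  assumes "v \<in> span (b ` {0<..})"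
  obtains u w where "u \<in> span (b ` {0<..s})" "w \<in> span (b ` {s<..})" "v = u + w"
proof -
  have "{0<..} = {0<..s} \<union> {s<..}" by auto
  then have "span (b ` {0<..}) = {u + w |u w. u \<in> span (b ` {0<..s}) \<and> w \<in> span (b ` {s<..})}"
    by (simp add: image_Un span_Un)
  then show ?thesis using assms that by blast
qed

text \<open>This is Grunblum's condition for a basic sequence, stated with spans instead of
  coefficients.\<close>

definition basis_const :: "real \<Rightarrow> (nat \<Rightarrow> 'a::real_normed_vector) \<Rightarrow> bool" where
  "basis_const C b \<longleftrightarrow> (\<forall>i>0. b i \<noteq> 0) \<and>
     (\<forall>s u v. u \<in> span (b ` {0<..s}) \<longrightarrow> v \<in> span (b ` {s<..}) \<longrightarrow> norm u \<le> C * norm (u + v))"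

text \<open>The bound \<open>k \<le> s + 2\<close>, one more than the \<open>k \<le> s + 1\<close> of the asymptotic \<open>\<ell>\<^sub>1\<close> inequality, is available
  on tails and makes the case \<open>s = 0\<close>, \<open>k = 2\<close> imply \<open>basis_const\<close>.\<close>

definition asymptotic_const :: "real \<Rightarrow> (nat \<Rightarrow> 'a::real_normed_vector) \<Rightarrow> bool" where
  "asymptotic_const C b \<longleftrightarrow> (\<forall>i>0. b i \<noteq> 0) \<and>
     (\<forall>k s t v T. blk b UNIV k s t v T \<longrightarrow> k \<le> s + 2 \<longrightarrow> T \<le> C * norm v)"

lemma basis_constD:
  "basis_const C b \<Longrightarrow> u \<in> span (b ` {0<..s}) \<Longrightarrow> v \<in> span (b ` {s<..}) \<Longrightarrow> norm u \<le> C * norm (u + v)"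
  unfolding basis_const_def by blast

lemma basis_const_ge_1:
  assumes "basis_const C b"
  shows "1 \<le> C"
proof -
  have "norm (b 1) \<le> C * norm (b 1 + 0)"
    by (rule basis_constD[OF assms, of _ 1]) (auto intro: span_base simp: span_zero)
  moreover have "b 1 \<noteq> 0" using assms unfolding basis_const_def by simp
  ultimately show ?thesis by simp
qed

lemma asymptotic_const_imp_basis_const:
  assumes "asymptotic_const C b"
  shows "basis_const C b"
  unfolding basis_const_def
proof (intro conjI allI impI)
  show "b i \<noteq> 0" if "i > 0" for i using assms that unfolding asymptotic_const_def by blast
  fix s u v assume u: "u \<in> span (b ` {0<..s})" and "v \<in> span (b ` {s<..})"
  then obtain t where t: "s \<le> t" "v \<in> span (b ` {s<..t})" using span_tail_bounded by metis
  have "blk b UNIV (1 + 1) 0 t (u + v) (norm u + norm v)"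
    using u t by (intro blk_append[of _ _ _ _ s _ _ _ s] blk_single) auto
  then have "norm u + norm v \<le> C * norm (u + v)"
    using assms unfolding asymptotic_const_def by fastforce
  then show "norm u \<le> C * norm (u + v)" using norm_ge_zero[of v] by linarith
qed

lemma partial_sum_in_span: "(\<Sum>i=1..k. a i *\<^sub>R b i) \<in> span (b ` {0<..k})" for b :: "nat \<Rightarrow> 'a::real_vector"
  by (intro span_sum span_scale span_base) auto

lemma norm_partial_sum_le:
  assumes "basis_const C b" "k \<le> n"
  shows "norm (\<Sum>i=1..k. a i *\<^sub>R b i) \<le> C * norm (\<Sum>i=1..n. a i *\<^sub>R b i)"
proof -
  have "(\<Sum>i=1..n. a i *\<^sub>R b i) = (\<Sum>i=1..k. a i *\<^sub>R b i) + (\<Sum>i\<in>{k<..n}. a i *\<^sub>R b i)"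
    using assms(2) by (subst sum.union_disjoint[symmetric]) (auto intro!: sum.cong)
  moreover have "(\<Sum>i\<in>{k<..n}. a i *\<^sub>R b i) \<in> span (b ` {k<..})"
    by (intro span_sum span_scale span_base) auto
  ultimately show ?thesis
    using basis_constD[OF assms(1) partial_sum_in_span] by metis
qed

text \<open>Partial sums of the difference of two expansions of one vector tend to 0, while each is
  bounded by \<open>C\<close> times the norm of any later one. Hence all of them vanish, and the
  coefficients agree one after another.\<close>

lemma unique_expansions_basis_const:
  assumes "basis_const C b"
  shows "unique_expansions b"
  unfolding unique_expansions_def
proof (intro allI impI)
  fix v a a' assume a: "is_expansion b v a" "is_expansion b v a'"
  define D where "D n = (\<Sum>i=1..n. (a i - a' i) *\<^sub>R b i)" for n
  have "D \<longlonglongrightarrow> v - v"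
    using a unfolding is_expansion_def D_def scaleR_diff_left sum_subtractf
    by (intro tendsto_diff) auto
  then have D0: "D \<longlonglongrightarrow> 0" by simp
  have "D k = 0" for k
  proof -
    have "\<forall>\<^sub>F n in sequentially. norm (D k) \<le> C * norm (D n)"
      unfolding D_def using norm_partial_sum_le[OF assms]
      by (intro eventually_sequentiallyI[of k]) auto
    then have "norm (D k) \<le> C * norm (0::'a)"
      by (intro tendsto_lowerbound[OF tendsto_mult_left[OF tendsto_norm[OF D0]]]) auto
    then show ?thesis by simp
  qed
  moreover have "D (Suc k) = D k + (a (Suc k) - a' (Suc k)) *\<^sub>R b (Suc k)" for k
    unfolding D_def by simp
  moreover have "b (Suc k) \<noteq> 0" for k using assms unfolding basis_const_def by simp
  ultimately have "a (Suc k) = a' (Suc k)" for k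
    by (metis add_0 eq_iff_diff_eq_0 scaleR_eq_0_iff)
  moreover have "a 0 = a' 0" using a unfolding is_expansion_def by simp
  ultimately show "a = a'" by (metis ext not0_implies_Suc)
qed

text \<open>The constant \<open>C\<close> survives because \<open>s \<le> p s\<close>: passing from
  \<open>w\<close> to \<open>b\<close> can only relax the restriction on the number of
  blocks.\<close>

lemma asymptotic_const_block:
  assumes "asymptotic_const C b" "mono p" "\<And>i. i \<le> p i"
    and "\<And>i. 0 < i \<Longrightarrow> w i \<in> span (b ` {p (i - 1)<..p i})" "\<And>i. 0 < i \<Longrightarrow> w i \<noteq> 0"
  shows "asymptotic_const C w"
  unfolding asymptotic_const_def
proof (intro conjI allI impI)
  fix k s t v T assume blk: "blk w UNIV k s t v T" and k: "k \<le> s + 2"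
  have "blk b UNIV k (p s) (p t) v T"
    by (rule blk_change_basis[OF blk assms(2) assms(4)]) auto
  moreover have "k \<le> p s + 2" using assms(3)[of s] k by linarith
  ultimately show "T \<le> C * norm v"
    using assms(1) unfolding asymptotic_const_def by blast
qed (use assms(5) in auto)

section \<open>The norm given by n intervals\<close>

text \<open>The projection onto the first \<open>s\<close> coordinates. It has meaning only on the
  algebraic span, where a basis constant makes the chosen vector unique
  (\<open>head_eqI\<close>).\<close>

definition head :: "(nat \<Rightarrow> 'a::real_vector) \<Rightarrow> nat \<Rightarrow> 'a \<Rightarrow> 'a" where
  "head b s v = (SOME u. u \<in> span (b ` {0<..s}) \<and> v - u \<in> span (b ` {s<..}))"

lemma head_props:
  assumes "v \<in> span (b ` {0<..})"
  shows "head b s v \<in> span (b ` {0<..s})" "v - head b s v \<in> span (b ` {s<..})"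
proof -
  obtain u w where "u \<in> span (b ` {0<..s})" "w \<in> span (b ` {s<..})" "v = u + w"
    using span_split_at[OF assms] by metis
  then have "\<exists>u. u \<in> span (b ` {0<..s}) \<and> v - u \<in> span (b ` {s<..})"
    by (intro exI[of _ u]) auto
  from someI_ex[OF this]
  show "head b s v \<in> span (b ` {0<..s})" "v - head b s v \<in> span (b ` {s<..})"
    unfolding head_def by auto
qed

context
  fixes C :: real and b :: "nat \<Rightarrow> 'a::real_normed_vector"
  assumes bc: "basis_const C b"
begin

lemma head_eqI:
  assumes "v \<in> span (b ` {0<..})" "u \<in> span (b ` {0<..s})" "v - u \<in> span (b ` {s<..})"
  shows "head b s v = u"
proof -
  note h = head_props[OF assms(1), of s]
  have "u - head b s v \<in> span (b ` {0<..s})" using h assms by (simp add: span_diff)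
  moreover have "(v - u) - (v - head b s v) \<in> span (b ` {s<..})" using h assms by (blast intro: span_diff)
  ultimately have "norm (u - head b s v) \<le> C * norm ((u - head b s v) + ((v - u) - (v - head b s v)))"
    using basis_constD[OF bc] by blast
  then show ?thesis by simp
qed

lemma head_add:
  assumes "v \<in> span (b ` {0<..})" "w \<in> span (b ` {0<..})"
  shows "head b s (v + w) = head b s v + head b s w"
  using head_props[OF assms(1), of s] head_props[OF assms(2), of s] assms
  by (intro head_eqI) (auto intro: span_add simp: add_diff_add)

lemma head_scaleR:
  assumes "v \<in> span (b ` {0<..})"
  shows "head b s (c *\<^sub>R v) = c *\<^sub>R head b s v"
  using head_props[OF assms(1), of s] assms
  by (intro head_eqI) (auto intro: span_scale simp: scaleR_diff_right[symmetric])

lemma head_eq_self: "v \<in> span (b ` {0<..t}) \<Longrightarrow> t \<le> s \<Longrightarrow> head b s v = v"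
  by (intro head_eqI) (auto simp: span_zero intro: span_image_mono)

lemma head_eq_0: "v \<in> span (b ` {t<..}) \<Longrightarrow> s \<le> t \<Longrightarrow> head b s v = 0"
  by (intro head_eqI) (auto simp: span_zero intro: span_image_mono)

lemma norm_head_le: "v \<in> span (b ` {0<..}) \<Longrightarrow> norm (head b s v) \<le> C * norm v"
  using basis_constD[OF bc head_props] by fastforce

text \<open>A monotone \<open>p\<close> cuts out adjacent, possibly empty intervals
  \<open>(p (j - 1), p j]\<close>; coordinates up to \<open>p 0\<close> or beyond \<open>p n\<close>
  do not count.\<close>

definition seg_sum :: "nat \<Rightarrow> (nat \<Rightarrow> nat) \<Rightarrow> 'a \<Rightarrow> real" where
  "seg_sum n p v = (\<Sum>j=1..n. norm (head b (p j) v - head b (p (j - 1)) v))"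

text \<open>A difference of two initial projections has norm at most \<open>2 * C\<close>. The bound
  is uniform in \<open>p\<close>, so the supremum in \<open>seg_norm\<close> is finite.\<close>

lemma seg_sum_le:
  assumes "v \<in> span (b ` {0<..})"
  shows "seg_sum n p v \<le> 2 * C * real n * norm v"
proof -
  have "seg_sum n p v \<le> (\<Sum>j=1..n. 2 * C * norm v)"
    unfolding seg_sum_def
  proof (rule sum_mono)
    fix j
    show "norm (head b (p j) v - head b (p (j - 1)) v) \<le> 2 * C * norm v"
      using norm_triangle_ineq4[of "head b (p j) v" "head b (p (j - 1)) v"]
        norm_head_le[OF assms, of "p j"] norm_head_le[OF assms, of "p (j - 1)"] by linarith
  qed
  then show ?thesis by (simp add: mult_ac)
qed

lemma seg_sum_add:
  assumes "v \<in> span (b ` {0<..})" "w \<in> span (b ` {0<..})"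
  shows "seg_sum n p (v + w) \<le> seg_sum n p v + seg_sum n p w"
  unfolding seg_sum_def sum.distrib[symmetric] head_add[OF assms] add_diff_add
  by (intro sum_mono norm_triangle_ineq)

lemma seg_sum_scaleR:
  assumes "v \<in> span (b ` {0<..})"
  shows "seg_sum n p (c *\<^sub>R v) = \<bar>c\<bar> * seg_sum n p v"
  unfolding seg_sum_def sum_distrib_left head_scaleR[OF assms]
  by (simp add: scaleR_diff_right[symmetric])

definition seg_norm :: "nat \<Rightarrow> 'a \<Rightarrow> real" where
  "seg_norm n v = (SUP p\<in>{p. mono p}. seg_sum n p v)"

lemma seg_sum_le_norm:
  assumes "v \<in> span (b ` {0<..})" "mono p"
  shows "seg_sum n p v \<le> seg_norm n v"
  unfolding seg_norm_def using seg_sum_le[OF assms(1)] assms(2)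
  by (intro cSUP_upper) (auto intro!: bdd_aboveI2)

lemma seg_norm_leI:
  assumes "\<And>p. mono p \<Longrightarrow> seg_sum n p v \<le> r"
  shows "seg_norm n v \<le> r"
  unfolding seg_norm_def using assms
  by (intro cSUP_least) (auto intro: exI[of _ id] simp: mono_def)

text \<open>The right ends of the block intervals serve as division points, so every block becomes a
  whole segment and contributes its full norm.\<close>

lemma blk_seg_sum:
  assumes "blk b U k 0 t v T"
  shows "\<exists>p. mono p \<and> p k = t \<and> T \<le> seg_sum k p v"
  using assms
proof (induction k "0::nat" t v T rule: blk.induct)
  case (blk_0 t)
  then show ?case by (intro exI[of _ "\<lambda>_. t"]) (auto simp: seg_sum_def mono_def)
next
  case (blk_Suc k t v T t' z)
  obtain p where p: "mono p" "p k = t" "T \<le> seg_sum k p v" using blk_Suc by blast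
  define q where "q i = (if i \<le> k then p i else t')" for i
  have pt: "p i \<le> t" if "i \<le> k" for i using monoD[OF p(1) that] p by simp
  then have "mono q" using monoD[OF p(1)] blk_Suc(3) unfolding mono_def q_def
    by (auto intro: order_trans)
  have vt: "v \<in> span (b ` {0<..t})" using blk_span blk_Suc(1) by blast
  have v: "v \<in> span (b ` {0<..})" "v \<in> span (b ` {0<..t'})"
    using blk_Suc(3) by (auto intro: span_image_mono[OF vt])
  have z: "z \<in> span (b ` {0<..})" "z \<in> span (b ` {t<..})" "z \<in> span (b ` {0<..t'})"
    by (auto intro: span_image_mono[OF blk_Suc(5)])
  \<comment> \<open>\<open>z\<close> starts beyond all earlier division points and so leaves the
    earlier segments unchanged.\<close>
  have h: "head b (q j) (v + z) = head b (p j) v" if "j \<le> k" for j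
    using head_add[OF v(1) z(1)] head_eq_0[OF z(2) pt[OF that]] that by (simp add: q_def)
  have "head b t' (v + z) = v + z"
    using v z by (intro head_eq_self[of _ t'] span_add) auto
  moreover have "head b t v = v" using vt head_eq_self by blast
  ultimately have "norm (head b (q (Suc k)) (v + z) - head b (q k) (v + z)) = norm z"
    using h[of k] p by (simp add: q_def)
  moreover have "(\<Sum>j=1..k. norm (head b (q j) (v + z) - head b (q (j - 1)) (v + z))) = seg_sum k p v"
    unfolding seg_sum_def using h by (intro sum.cong) auto
  ultimately have "seg_sum (Suc k) q (v + z) = seg_sum k p v + norm z"
    unfolding seg_sum_def by simp
  then show ?case using p \<open>mono q\<close> by (intro exI[of _ q]) (auto simp: q_def)
qed

text \<open>This lower estimate makes the new norm large at the sum of a tuple with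
  \<open>norm v < \<theta> * T\<close>.\<close>

lemma blk_le_seg_norm:
  assumes "blk b U k s t v T"
  shows "T \<le> seg_norm k v"
proof -
  have *: "blk b U k 0 t v T" by (rule blk_mono[OF assms]) auto
  have "v \<in> span (b ` {0<..})" using blk_span[OF *] by (rule span_image_mono) auto
  then show ?thesis using blk_seg_sum[OF *] seg_sum_le_norm by (meson order_trans)
qed

lemma norm_le_seg_norm:
  assumes "v \<in> span (b ` {0<..})" "n \<ge> 1"
  shows "norm v \<le> seg_norm n v"
proof -
  obtain t where "v \<in> span (b ` {0<..t})" using span_tail_bounded[OF assms(1)] by metis
  then have "blk b UNIV 1 0 t v (norm v)" by (intro blk_single) auto
  then have "blk b UNIV n 0 t v (norm v)" by (rule blk_mono) (use assms in auto)
  then show ?thesis by (rule blk_le_seg_norm)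
qed

text \<open>A block whose interval contains no division point in its interior lies in a single segment,
  so it contributes only its norm; there are at most \<open>n + 1\<close> other blocks.\<close>

lemma seg_sum_block_le:
  assumes "z \<in> span (b ` {t<..t'})" "mono p" "\<And>j. j \<le> n \<Longrightarrow> \<not> (t < p j \<and> p j < t')"
  shows "seg_sum n p z \<le> norm z"
proof -
  have h: "head b (p j) z = (if p j \<le> t then 0 else z)" if "j \<le> n" for j
  proof -
    have "z \<in> span (b ` {t<..})" "z \<in> span (b ` {0<..t'})"
      by (auto intro: span_image_mono[OF assms(1)])
    then show ?thesis using head_eq_0[of z t "p j"] head_eq_self[of z t' "p j"] assms(3)[OF that] by auto
  qed
  have "(\<Sum>j=1..m. norm (head b (p j) z - head b (p (j - 1)) z)) \<le> norm (head b (p m) z)"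
    if "m \<le> n" for m
    using that
  proof (induction m)
    case (Suc m)
    then show ?case using h[of m] h[of "Suc m"] monoD[OF assms(2), of m "Suc m"]
      by (auto split: if_splits)
  qed auto
  from this[of n] h[of n] show ?thesis
    unfolding seg_sum_def by (auto split: if_splits intro: order_trans)
qed

text \<open>The cardinality counts the division points passed so far. A block with a division point
  strictly inside its interval gets the crude bound \<open>2 * C * n\<close>, charged to that point;
  every other block costs at most its norm 1.\<close>

lemma seg_sum_unit_blocks:
  assumes "blk b (sphere 0 1) m s t u T" "mono p"
  shows "seg_sum n p u \<le> m + 2 * C * n * card {j. j \<le> n \<and> p j < t}"
  using assms(1)
proof (induction rule: blk.induct)
  case (blk_0 s t)
  have "(0::'a) \<in> span (b ` {0<..})" by (simp add: span_zero)
  then have "seg_sum n p 0 \<le> 0" using seg_sum_le[of 0 n p] by simp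
  then show ?case using basis_const_ge_1[OF bc] by (auto intro: order_trans)
next
  case (blk_Suc m s t v T t' z)
  let ?c = "\<lambda>t. card {j. j \<le> n \<and> p j < t}"
  have z: "norm z = 1" using blk_Suc by simp
  have "v \<in> span (b ` {0<..})" by (rule span_image_mono[OF blk_span[OF blk_Suc(1)]]) auto
  moreover have zs: "z \<in> span (b ` {0<..})" by (rule span_image_mono[OF blk_Suc(4)]) auto
  ultimately have add: "seg_sum n p (v + z) \<le> seg_sum n p v + seg_sum n p z" by (rule seg_sum_add)
  have sub: "{j. j \<le> n \<and> p j < t} \<subseteq> {j. j \<le> n \<and> p j < t'}" using blk_Suc by auto
  have C: "0 \<le> 2 * C * n" using basis_const_ge_1[OF bc] by simp
  show ?case
  proof (cases "\<exists>j\<le>n. t < p j \<and> p j < t'")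
    case False
    then have "seg_sum n p z \<le> 1" using seg_sum_block_le[OF blk_Suc(4) assms(2)] z by metis
    moreover have "?c t \<le> ?c t'" using sub by (intro card_mono) auto
    ultimately show ?thesis using blk_Suc.IH add mult_left_mono[OF _ C, of "real (?c t)" "real (?c t')"] by simp
  next
    case True
    then obtain j where "j \<le> n" "t < p j" "p j < t'" by blast
    then have "j \<in> {j. j \<le> n \<and> p j < t'}" "j \<notin> {j. j \<le> n \<and> p j < t}" by auto
    then have "{j. j \<le> n \<and> p j < t} \<subset> {j. j \<le> n \<and> p j < t'}" using sub by blast
    then have "?c t < ?c t'" by (intro psubset_card_mono) auto
    then have "2 * C * n * (real (?c t) + 1) \<le> 2 * C * n * ?c t'"
      by (intro mult_left_mono[OF _ C]) auto
    moreover have "seg_sum n p z \<le> 2 * C * n" using seg_sum_le[OF zs] z by simp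
    ultimately show ?thesis using blk_Suc.IH add by (simp add: distrib_left)
  qed
qed

text \<open>The excess over \<open>m\<close> does not depend on \<open>m\<close>, so it becomes
  negligible for long sums.\<close>

lemma seg_norm_unit_blocks:
  assumes "blk b (sphere 0 1) m s t u T"
  shows "seg_norm n u \<le> real m + 2 * C * real n * (real n + 1)"
proof (rule seg_norm_leI)
  fix p :: "nat \<Rightarrow> nat" assume p: "mono p"
  have "card {j. j \<le> n \<and> p j < t} \<le> card {..n}" by (intro card_mono) auto
  then have "2 * C * real n * real (card {j. j \<le> n \<and> p j < t}) \<le> 2 * C * real n * (real n + 1)"
    using basis_const_ge_1[OF bc] by (intro mult_left_mono) auto
  then show "seg_sum n p u \<le> real m + 2 * C * real n * (real n + 1)"
    using seg_sum_unit_blocks[OF assms p, of n] by linarith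
qed

end

section \<open>Extending an equivalent norm from a subspace\<close>

text \<open>\<open>seg_norm\<close> is controlled only on finitely supported vectors, whereas
  distortion concerns closed spans. The extension is the infimal convolution of \<open>N\<close>
  with \<open>\<beta> * norm\<close>; it agrees with \<open>N\<close> on \<open>S\<close> because
  \<open>N \<le> \<beta> * norm\<close> there.\<close>

lemma extend_norm:
  fixes S :: "'a::real_normed_vector set"
  assumes S: "subspace S" and "0 < a" "a \<le> \<beta>"
    and lower: "\<And>u. u \<in> S \<Longrightarrow> a * norm u \<le> N u" and upper: "\<And>u. u \<in> S \<Longrightarrow> N u \<le> \<beta> * norm u"
    and add: "\<And>u v. u \<in> S \<Longrightarrow> v \<in> S \<Longrightarrow> N (u + v) \<le> N u + N v"
    and scale: "\<And>c u. u \<in> S \<Longrightarrow> N (c *\<^sub>R u) = \<bar>c\<bar> * N u"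
  obtains N' where "equivalent_norm_on UNIV N'" "\<And>u. u \<in> S \<Longrightarrow> N' u = N u" "\<And>v. N' v \<le> \<beta> * norm v"
proof -
  define N' where "N' v = (INF u\<in>S. N u + \<beta> * norm (v - u))" for v
  have ge: "a * norm v \<le> N u + \<beta> * norm (v - u)" if "u \<in> S" for u v
  proof -
    have "a * norm v \<le> a * (norm u + norm (v - u))"
      using \<open>0 < a\<close> norm_triangle_sub[of v u] by (intro mult_left_mono) auto
    also have "\<dots> \<le> N u + \<beta> * norm (v - u)"
      using lower[OF that] mult_right_mono[OF \<open>a \<le> \<beta>\<close>, of "norm (v - u)"] by (simp add: distrib_left)
    finally show ?thesis .
  qed
  have bdd: "bdd_below ((\<lambda>u. N u + \<beta> * norm (v - u)) ` S)" for v
    using ge by (intro bdd_belowI2)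
  have ne: "S \<noteq> {}" using subspace_0[OF S] by auto
  have le: "N' v \<le> N u + \<beta> * norm (v - u)" if "u \<in> S" for u v
    unfolding N'_def using bdd that by (rule cINF_lower)
  have greatest: "r \<le> N' v" if "\<And>u. u \<in> S \<Longrightarrow> r \<le> N u + \<beta> * norm (v - u)" for r v
    unfolding N'_def using ne that by (rule cINF_greatest)
  have lo: "a * norm v \<le> N' v" for v
    using greatest ge by blast
  have "N 0 = 0" using lower[OF subspace_0[OF S]] upper[OF subspace_0[OF S]] by simp
  then have up: "N' v \<le> \<beta> * norm v" for v
    using le[OF subspace_0[OF S], of v] by simp
  have eq: "N' u = N u" if u: "u \<in> S" for u
  proof (rule antisym)
    show "N' u \<le> N u" using le[OF u, of u] by simp
    show "N u \<le> N' u"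
    proof (rule greatest)
      fix w assume w: "w \<in> S"
      then show "N u \<le> N w + \<beta> * norm (u - w)"
        using add[OF w subspace_diff[OF S u w]] upper[OF subspace_diff[OF S u w]] by simp
    qed
  qed
  have tri: "N' (x + y) \<le> N' x + N' y" for x y
  proof -
    have "N' (x + y) - N' y \<le> N' x"
    proof (rule greatest)
      fix u assume u: "u \<in> S"
      have "N' (x + y) - (N u + \<beta> * norm (x - u)) \<le> N' y"
      proof (rule greatest)
        fix w assume w: "w \<in> S"
        have "norm (x + y - (u + w)) \<le> norm (x - u) + norm (y - w)"
          using norm_triangle_ineq[of "x - u" "y - w"] by (simp add: algebra_simps)
        then have "\<beta> * norm (x + y - (u + w)) \<le> \<beta> * norm (x - u) + \<beta> * norm (y - w)"
          using assms(2,3) mult_left_mono[of _ _ \<beta>] by (fastforce simp: distrib_left[symmetric])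
        then show "N' (x + y) - (N u + \<beta> * norm (x - u)) \<le> N w + \<beta> * norm (y - w)"
          using le[OF subspace_add[OF S u w], of "x + y"] add[OF u w] by linarith
      qed
      then show "N' (x + y) - N' y \<le> N u + \<beta> * norm (x - u)" by linarith
    qed
    then show ?thesis by linarith
  qed
  have zero: "N' 0 = 0" using lo[of 0] up[of 0] by simp
  have hom_le: "N' (c *\<^sub>R x) \<le> \<bar>c\<bar> * N' x" if c: "c \<noteq> 0" for c x
  proof -
    have "N' (c *\<^sub>R x) / \<bar>c\<bar> \<le> N' x"
    proof (rule greatest)
      fix u assume u: "u \<in> S"
      have "N' (c *\<^sub>R x) \<le> \<bar>c\<bar> * (N u + \<beta> * norm (x - u))"
        using le[OF subspace_scale[OF S u, of c], of "c *\<^sub>R x"] scale[OF u, of c]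
        by (simp add: scaleR_diff_right[symmetric] distrib_left mult.left_commute)
      then show "N' (c *\<^sub>R x) / \<bar>c\<bar> \<le> N u + \<beta> * norm (x - u)"
        using c by (simp add: divide_le_eq mult.commute)
    qed
    then show ?thesis using c by (simp add: divide_le_eq mult.commute)
  qed
  have hom: "N' (c *\<^sub>R x) = \<bar>c\<bar> * N' x" for c x
  proof (cases "c = 0")
    case False
    \<comment> \<open>Scaling back by \<open>inverse c\<close> turns the one-sided estimate into the
      reverse one.\<close>
    have "N' (inverse c *\<^sub>R (c *\<^sub>R x)) \<le> \<bar>inverse c\<bar> * N' (c *\<^sub>R x)"
      using False by (intro hom_le) auto
    then have "\<bar>c\<bar> * N' x \<le> N' (c *\<^sub>R x)" using False by (simp add: field_simps)
    then show ?thesis using hom_le[OF False, of x] by linarith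
  qed (simp add: zero)
  have pos: "0 \<le> N' x" for x
    using lo[of x] mult_nonneg_nonneg[of a "norm x"] assms(2) norm_ge_zero[of x] by linarith
  have pos': "N' x = 0 \<longleftrightarrow> x = 0" for x
  proof
    assume "N' x = 0"
    then show "x = 0" using lo[of x] mult_pos_pos[OF assms(2), of "norm x"] by fastforce
  qed (simp add: zero)
  have "0 < \<beta>" using assms(2,3) by linarith
  then have "\<exists>a>0. \<exists>b>0. \<forall>x\<in>UNIV. a * norm x \<le> N' x \<and> N' x \<le> b * norm x"
    using lo up assms(2) by blast
  then have "equivalent_norm_on UNIV N'"
    unfolding equivalent_norm_on_def using pos pos' hom tri by simp
  then show ?thesis using that eq up by blast
qed

section \<open>Almost isometric copies of finite-dimensional l1\<close>

text \<open>An algebraic stand-in for block subspaces: every such \<open>V\<close> contains block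
  sequences of \<open>b\<close>, picked from successive tails, and spans of block sequences are of
  this kind (\<open>big_subspace_blocks\<close>). No closure is taken, so all vectors keep finite
  support.\<close>

definition big_subspace :: "(nat \<Rightarrow> 'a::real_normed_vector) \<Rightarrow> 'a set \<Rightarrow> bool" where
  "big_subspace b V \<longleftrightarrow> subspace V \<and> V \<subseteq> span (b ` {0<..}) \<and>
     (\<forall>s. \<exists>v\<in>V. v \<noteq> 0 \<and> v \<in> span (b ` {s<..}))"

lemma big_subspace_unit:
  assumes "big_subspace b V"
  obtains v t where "v \<in> V" "norm v = 1" "v \<in> span (b ` {s<..t})" "s \<le> t"
proof -
  obtain v where v: "v \<in> V" "v \<noteq> 0" "v \<in> span (b ` {s<..})"
    using assms unfolding big_subspace_def by blast
  obtain t where t: "s \<le> t" "v \<in> span (b ` {s<..t})" using span_tail_bounded[OF v(3)] by metis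
  have "(1 / norm v) *\<^sub>R v \<in> V"
    using assms v(1) unfolding big_subspace_def by (blast intro: subspace_scale)
  then show ?thesis
    using that[of "(1 / norm v) *\<^sub>R v" t] t v(2) by (simp add: span_scale)
qed

text \<open>James' non-distortion argument for \<open>\<ell>\<^sub>1\<close>: if all sums of \<open>m\<close> unit blocks were shorter than
  \<open>(1 - \<epsilon>) m\<close>, then normalizing such sums and iterating \<open>r\<close> times would give a unit vector that
  is the sum of \<open>m ^ r\<close> blocks of total norm at least \<open>(1 - \<epsilon>) ^ (- r)\<close>.\<close>

lemma ex_almost_isometric_l1_blocks:
  assumes asy: "asymptotic_const C b" and big: "big_subspace b V" and m: "1 \<le> m" and \<epsilon>: "0 < \<epsilon>" "\<epsilon> < 1"
  shows "\<exists>s t u T. blk b (V \<inter> sphere 0 1) m s t u T \<and> (1 - \<epsilon>) * m < norm u"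
proof (rule ccontr)
  assume "\<not> ?thesis"
  then have short: "norm u \<le> (1 - \<epsilon>) * m" if "blk b (V \<inter> sphere 0 1) m s t u T" for s t u T
    using that not_less by blast
  define q where "q = 1 / (1 - \<epsilon>)"
  have q: "1 < q" using \<epsilon> by (simp add: q_def)
  have V: "subspace V" using big unfolding big_subspace_def by blast
  have asyD: "T \<le> C * norm v" if "blk b UNIV k s t v T" "k \<le> s" for k s t v T
    using asy that unfolding asymptotic_const_def by (meson trans_le_add1)
  \<comment> \<open>Starting beyond \<open>m ^ Suc r\<close> makes the asymptotic inequality
    applicable not only to \<open>m ^ r\<close> blocks but also to the \<open>m ^ Suc r\<close>
    blocks of a sum of \<open>m\<close> such vectors.\<close>
  have claim: "\<exists>t v T. v \<in> V \<and> norm v = 1 \<and> blk b UNIV (m ^ r) s t v T \<and> q ^ r \<le> T \<and>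
      v \<in> span (b ` {s<..t})" if "m ^ Suc r \<le> s" for r s
    using that
  proof (induction r arbitrary: s)
    case 0
    obtain v t where v: "v \<in> V" "norm v = 1" "v \<in> span (b ` {s<..t})" "s \<le> t"
      using big_subspace_unit[OF big] by metis
    then have "blk b UNIV 1 s t v (norm v)" by (intro blk_single) auto
    then show ?case using v by (intro exI[of _ t] exI[of _ v] exI[of _ 1]) simp
  next
    case (Suc r)
    have le: "m ^ Suc r \<le> s" using Suc.prems m
      by (metis le_trans mult_le_mono1 nat_mult_1 power_Suc)
    \<comment> \<open>The same \<open>u\<close> is recorded twice: as a sum of \<open>i\<close> unit
      vectors of \<open>V\<close>, to which \<open>short\<close> applies, and as a sum of
      \<open>i * m ^ r\<close> finer blocks of large total norm.\<close>
    have "\<exists>t u T T'. blk b (V \<inter> sphere 0 1) i s t u T' \<and> blk b UNIV (i * m ^ r) s t u T \<and> i * q ^ r \<le> T" for i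
    proof (induction i)
      case 0
      have "blk b (V \<inter> sphere 0 1) 0 s s 0 0" "blk b UNIV 0 s s 0 0" by (auto intro: blk.intros)
      then show ?case by fastforce
    next
      case (Suc i)
      then obtain t u T T' where t: "blk b (V \<inter> sphere 0 1) i s t u T'"
        "blk b UNIV (i * m ^ r) s t u T" "i * q ^ r \<le> T" by blast
      have st: "s \<le> t" using blk_le[OF t(1)] .
      then obtain t' v T1 where v: "v \<in> V" "norm v = 1" "blk b UNIV (m ^ r) t t' v T1" "q ^ r \<le> T1"
        "v \<in> span (b ` {t<..t'})"
        using Suc.IH \<open>\<And>s. m ^ Suc r \<le> s \<Longrightarrow> _\<close> le by (meson le_trans)
      have "blk b (V \<inter> sphere 0 1) (Suc i) s t' (u + v) (T' + norm v)"
        using v by (intro blk_Suc[OF t(1)] blk_le[OF v(3)]) auto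
      moreover have "blk b UNIV (Suc i * m ^ r) s t' (u + v) (T + T1)"
        using blk_append[OF t(2) v(3)] by (simp add: add.commute)
      moreover have "Suc i * q ^ r \<le> T + T1" using t(3) v(4) by (simp add: distrib_right)
      ultimately show ?case by blast
    qed
    then obtain t u T T' where u: "blk b (V \<inter> sphere 0 1) m s t u T'"
      "blk b UNIV (m * m ^ r) s t u T" "m * q ^ r \<le> T" by blast
    have "0 < m * q ^ r" using m q by simp
    \<comment> \<open>The asymptotic inequality keeps \<open>u\<close> away from 0, so it can be
      normalized.\<close>
    then have "0 < T" "T \<le> C * norm u" using u(3) asyD[OF u(2)] le by auto
    then have u0: "norm u > 0" by auto
    define v where "v = (1 / norm u) *\<^sub>R u"
    have "u \<in> V" using blk_in[OF u(1) V] by blast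
    then have "v \<in> V" "norm v = 1" using V u0 by (auto simp: v_def subspace_scale)
    moreover have "blk b UNIV (m ^ Suc r) s t v (\<bar>1 / norm u\<bar> * T)"
      unfolding v_def power_Suc by (rule blk_scale[OF u(2)]) simp
    moreover have "q ^ Suc r \<le> \<bar>1 / norm u\<bar> * T"
    proof -
      \<comment> \<open>Since \<open>norm u \<le> m / q\<close>, normalizing gains one more factor
        \<open>q\<close>.\<close>
      have "q ^ Suc r * norm u \<le> q ^ Suc r * ((1 - \<epsilon>) * m)"
        using short[OF u(1)] q by (intro mult_left_mono) auto
      also have "\<dots> = m * q ^ r" using \<epsilon> by (simp add: q_def)
      also note u(3)
      finally show ?thesis using u0 by (simp add: field_simps)
    qed
    moreover have "v \<in> span (b ` {s<..t})"
      unfolding v_def by (intro span_scale blk_span[OF u(1)])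
    ultimately show ?case by blast
  qed
  obtain r where r: "C < q ^ r" using real_arch_pow[OF q] by blast
  obtain t v T where v: "norm v = 1" "blk b UNIV (m ^ r) (m ^ Suc r) t v T" "q ^ r \<le> T"
    using claim[OF order_refl, of r] by blast
  have "m ^ r \<le> m ^ Suc r" using m by (intro power_increasing) auto
  then show False using asyD[OF v(2)] v r by simp
qed

section \<open>Approximating subspaces by block subspaces\<close>

lemma subspace_closure:
  fixes S :: "'a::real_normed_vector set"
  assumes "subspace S"
  shows "subspace (closure S)"
proof (rule subspaceI)
  show "0 \<in> closure S" using subspace_0[OF assms] closure_subset by blast
next
  fix x y assume "x \<in> closure S" "y \<in> closure S"
  then obtain f g where "\<And>n. f n \<in> S" "f \<longlonglongrightarrow> x" "\<And>n. g n \<in> S" "g \<longlonglongrightarrow> y"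
    unfolding closure_sequential by blast
  then show "x + y \<in> closure S"
    unfolding closure_sequential
    by (intro exI[of _ "\<lambda>n. f n + g n"] conjI allI subspace_add[OF assms] tendsto_add)
next
  fix c x assume "x \<in> closure S"
  then obtain f where "\<And>n. f n \<in> S" "f \<longlonglongrightarrow> x"
    unfolding closure_sequential by blast
  then show "c *\<^sub>R x \<in> closure S"
    unfolding closure_sequential
    by (intro exI[of _ "\<lambda>n. c *\<^sub>R f n"] conjI allI subspace_scale[OF assms] tendsto_scaleR tendsto_const)
qed

text \<open>The basis constant makes the leading coefficients of finite approximations to
  \<open>v\<close> a Cauchy sequence; their limit is the required \<open>c\<close>.\<close>

lemma closed_span_tail_step:
  fixes y :: "nat \<Rightarrow> 'a::real_normed_vector"
  assumes "basis_const C y" "v \<in> closure (span (y ` {k<..}))"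
  shows "\<exists>c. v - c *\<^sub>R y (Suc k) \<in> closure (span (y ` {Suc k<..}))"
proof -
  obtain s where s: "\<And>i. s i \<in> span (y ` {k<..})" "s \<longlonglongrightarrow> v"
    using assms(2) unfolding closure_sequential by blast
  have "{k<..} = insert (Suc k) {Suc k<..}" by auto
  then have "\<exists>c. s i - c *\<^sub>R y (Suc k) \<in> span (y ` {Suc k<..})" for i
    using s(1)[of i] by (simp add: span_breakdown_eq)
  then obtain c where c: "\<And>i. s i - c i *\<^sub>R y (Suc k) \<in> span (y ` {Suc k<..})" by metis
  define L where "L = norm (y (Suc k))"
  have L: "0 < L" using assms(1) unfolding basis_const_def L_def by simp
  have C: "1 \<le> C" using basis_const_ge_1[OF assms(1)] .
  have diff: "\<bar>c i - c j\<bar> * L \<le> C * norm (s i - s j)" for i j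
  proof -
    have "(c i - c j) *\<^sub>R y (Suc k) \<in> span (y ` {0<..Suc k})"
      by (intro span_scale span_base) auto
    moreover have "(s i - c i *\<^sub>R y (Suc k)) - (s j - c j *\<^sub>R y (Suc k)) \<in> span (y ` {Suc k<..})"
      by (intro span_diff c)
    ultimately have "norm ((c i - c j) *\<^sub>R y (Suc k)) \<le> C * norm ((c i - c j) *\<^sub>R y (Suc k) +
        ((s i - c i *\<^sub>R y (Suc k)) - (s j - c j *\<^sub>R y (Suc k))))"
      by (rule basis_constD[OF assms(1)])
    also have "(c i - c j) *\<^sub>R y (Suc k) + ((s i - c i *\<^sub>R y (Suc k)) - (s j - c j *\<^sub>R y (Suc k))) = s i - s j"
      by (simp add: algebra_simps)
    finally show ?thesis by (simp add: L_def)
  qed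
  have "Cauchy c"
  proof (rule metric_CauchyI)
    fix e :: real assume "0 < e"
    then have "0 < e * L / C" using L C by simp
    then obtain M where M: "\<And>i j. i \<ge> M \<Longrightarrow> j \<ge> M \<Longrightarrow> dist (s i) (s j) < e * L / C"
      using LIMSEQ_imp_Cauchy[OF s(2)] unfolding Cauchy_def by metis
    have "dist (c i) (c j) < e" if "i \<ge> M" "j \<ge> M" for i j
    proof -
      have "C * norm (s i - s j) < e * L" using M[OF that] C by (simp add: dist_norm field_simps)
      then have "\<bar>c i - c j\<bar> * L < e * L" using diff[of i j] by linarith
      then show ?thesis using L by (simp add: dist_real_def)
    qed
    then show "\<exists>M. \<forall>i\<ge>M. \<forall>j\<ge>M. dist (c i) (c j) < e" by blast
  qed
  then obtain c0 where "c \<longlonglongrightarrow> c0" using Cauchy_convergent_iff convergent_def by blast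
  then have "(\<lambda>i. s i - c i *\<^sub>R y (Suc k)) \<longlonglongrightarrow> v - c0 *\<^sub>R y (Suc k)"
    using s(2) by (intro tendsto_intros)
  then show ?thesis
    using c unfolding closure_sequential
    by (intro exI[of _ c0] exI[of _ "\<lambda>i. s i - c i *\<^sub>R y (Suc k)"]) simp
qed

text \<open>Passing from one closed tail span to the next removes one coordinate, hence at most one
  dimension of \<open>Z\<close>.\<close>

lemma infinite_dimensional_meets_tail:
  fixes y :: "nat \<Rightarrow> 'a::real_normed_vector"
  assumes y: "basis_const C y" and Z: "inf_dim_subspace Z" "Z \<subseteq> closed_span y"
  shows "\<not> (\<exists>B. finite B \<and> Z \<inter> closure (span (y ` {k<..})) \<subseteq> span B)"
proof (induction k)
  case 0
  have "Z \<inter> closure (span (y ` {0<..})) = Z"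
    using Z(2) unfolding closed_span_def atLeast_one_eq by blast
  then show ?case using Z(1) unfolding inf_dim_subspace_def by auto
next
  case (Suc k)
  let ?W = "\<lambda>k. closure (span (y ` {k<..}))"
  have sub: "subspace Z" "\<And>k. subspace (?W k)"
    using Z(1) unfolding inf_dim_subspace_def by (auto intro: subspace_closure)
  show ?case
  proof
    assume "\<exists>B. finite B \<and> Z \<inter> ?W (Suc k) \<subseteq> span B"
    then obtain B where B: "finite B" "Z \<inter> ?W (Suc k) \<subseteq> span B" by blast
    have "\<exists>B. finite B \<and> Z \<inter> ?W k \<subseteq> span B"
    proof (cases "Z \<inter> ?W k \<subseteq> ?W (Suc k)")
      case True
      then show ?thesis using B by blast
    next
      case False
      then obtain z0 where z0: "z0 \<in> Z" "z0 \<in> ?W k" "z0 \<notin> ?W (Suc k)" by blast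
      obtain c0 where c0: "z0 - c0 *\<^sub>R y (Suc k) \<in> ?W (Suc k)"
        using closed_span_tail_step[OF y z0(2)] by blast
      have nz: "c0 \<noteq> 0" using c0 z0(3) by auto
      \<comment> \<open>Subtracting the multiple of \<open>z0\<close> that cancels the coordinate
        \<open>Suc k\<close> puts \<open>z\<close> into the next tail without leaving
        \<open>Z\<close>.\<close>
      have "z \<in> span (insert z0 B)" if z: "z \<in> Z" "z \<in> ?W k" for z
      proof -
        obtain c where c: "z - c *\<^sub>R y (Suc k) \<in> ?W (Suc k)"
          using closed_span_tail_step[OF y z(2)] by blast
        have "(z - c *\<^sub>R y (Suc k)) - (c / c0) *\<^sub>R (z0 - c0 *\<^sub>R y (Suc k)) \<in> ?W (Suc k)"
          by (rule subspace_diff[OF sub(2) c subspace_scale[OF sub(2) c0]])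
        also have "(z - c *\<^sub>R y (Suc k)) - (c / c0) *\<^sub>R (z0 - c0 *\<^sub>R y (Suc k)) = z - (c / c0) *\<^sub>R z0"
          using nz by (simp add: scaleR_diff_right)
        finally have "z - (c / c0) *\<^sub>R z0 \<in> span B"
          using B(2) subspace_diff[OF sub(1) z(1) subspace_scale[OF sub(1) z0(1)]] by blast
        then show ?thesis by (auto simp: span_breakdown_eq)
      qed
      then show ?thesis using B(1) by (intro exI[of _ "insert z0 B"]) auto
    qed
    then show False using Suc.IH by blast
  qed
qed

lemma inf_dim_subspace_near_tail:
  fixes y :: "nat \<Rightarrow> 'a::real_normed_vector"
  assumes y: "basis_const C y" and Z: "inf_dim_subspace Z" "Z \<subseteq> closed_span y" and \<eta>: "0 < \<eta>"
  shows "\<exists>z d. z \<in> Z \<and> d \<in> span (y ` {k<..}) \<and> norm d = 1 \<and> norm (z - d) \<le> \<eta>"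
proof -
  have sub: "subspace Z" using Z(1) unfolding inf_dim_subspace_def by blast
  have "\<not> Z \<inter> closure (span (y ` {k<..})) \<subseteq> span {}"
    using infinite_dimensional_meets_tail[OF y Z, of k] by blast
  then obtain z where z: "z \<in> Z" "z \<in> closure (span (y ` {k<..}))" "z \<noteq> 0" by auto
  \<comment> \<open>The first bound keeps \<open>norm d\<close> above \<open>norm z / 2\<close>; the
    second then makes the error at most \<open>\<eta> * norm d\<close>, which is what remains after
    normalizing \<open>d\<close>.\<close>
  define e where "e = min (norm z / 2) (\<eta> * norm z / 2)"
  have "0 < e" using z(3) \<eta> by (simp add: e_def)
  then obtain d where d: "d \<in> span (y ` {k<..})" "dist d z < e"
    using z(2) unfolding closure_approachable by blast
  have "norm z - norm d \<le> norm (z - d)" by (rule norm_triangle_ineq2)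
  moreover have zd: "norm (z - d) < e" using d(2) by (simp add: dist_norm norm_minus_commute)
  ultimately have nd: "norm z / 2 < norm d" by (simp add: e_def)
  then have nd0: "0 < norm d" using norm_ge_zero[of z] by linarith
  have "norm (z - d) \<le> \<eta> * (norm z / 2)" using zd by (simp add: e_def)
  also have "\<dots> \<le> \<eta> * norm d" using nd \<eta> by (intro mult_left_mono) auto
  finally have "norm ((1 / norm d) *\<^sub>R (z - d)) \<le> \<eta>" using nd0 by (simp add: divide_le_eq)
  then have "norm ((1 / norm d) *\<^sub>R z - (1 / norm d) *\<^sub>R d) \<le> \<eta>" by (simp add: scaleR_diff_right)
  moreover have "(1 / norm d) *\<^sub>R z \<in> Z" using sub z(1) by (rule subspace_scale)
  moreover have "(1 / norm d) *\<^sub>R d \<in> span (y ` {k<..})" using d(1) by (rule span_scale)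
  moreover have "norm ((1 / norm d) *\<^sub>R d) = 1" using nd0 by simp
  ultimately show ?thesis by blast
qed

lemma big_subspace_blocks:
  assumes "\<And>i. 0 < i \<Longrightarrow> d i \<in> span (b ` {p (i - 1)<..p i})" "\<And>i. 0 < i \<Longrightarrow> d i \<noteq> 0"
    "\<And>i. i \<le> p i"
  shows "big_subspace b (span (d ` {0<..}))"
  unfolding big_subspace_def
proof (intro conjI allI)
  show "span (d ` {0<..}) \<subseteq> span (b ` {0<..})"
  proof (rule span_minimal)
    have "d i \<in> span (b ` {0<..})" if "0 < i" for i
      by (rule span_image_mono[OF assms(1)[OF that]]) auto
    then show "d ` {0<..} \<subseteq> span (b ` {0<..})" by auto
  qed simp
  fix s
  have "d (Suc s) \<in> span (b ` {s<..})"
    by (rule span_image_mono[OF assms(1)]) (use assms(3)[of s] in auto)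
  moreover have "d (Suc s) \<in> span (d ` {0<..})" by (intro span_base) auto
  ultimately show "\<exists>v\<in>span (d ` {0<..}). v \<noteq> 0 \<and> v \<in> span (b ` {s<..})" using assms(2)[of "Suc s"] by blast
qed simp

lemma sum_half_powers_le: "(\<Sum>i=1..n. (1 / 2) ^ i) \<le> (1::real)"
proof -
  have "(\<Sum>i=1..n. (1 / 2) ^ i) = 1 - (1 / 2 :: real) ^ n" by (induction n) auto
  then show ?thesis by simp
qed

text \<open>A gliding hump: unit vectors \<open>d n\<close> with successive finite supports are
  chosen summably close to \<open>Z\<close>. Coefficients along \<open>d\<close> are bounded by the
  norm, so replacing each \<open>d n\<close> by its neighbour in \<open>Z\<close> moves every
  combination only slightly.\<close>

lemma inf_dim_subspace_near_big_subspace: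
  fixes b :: "nat \<Rightarrow> 'a::real_normed_vector"
  assumes asy: "asymptotic_const C b"
    and y: "\<And>i. 0 < i \<Longrightarrow> y i \<in> span (b ` {p (i - 1)<..p i})" "\<And>i. 0 < i \<Longrightarrow> y i \<noteq> 0"
      "mono p" "\<And>i. i \<le> p i"
    and Z: "inf_dim_subspace Z" "Z \<subseteq> closed_span y" and \<eta>: "0 < \<eta>"
  shows "\<exists>V. big_subspace b V \<and> V \<subseteq> span (y ` {0<..}) \<and> (\<forall>v\<in>V. \<exists>z\<in>Z. norm (v - z) \<le> \<eta> * norm v)"
proof -
  have bcy: "basis_const C y"
    by (rule asymptotic_const_imp_basis_const[OF asymptotic_const_block[OF asy y(3,4,1,2)]])
  have sub: "subspace Z" using Z(1) unfolding inf_dim_subspace_def by blast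
  have C: "1 \<le> C" using basis_const_ge_1[OF bcy] .
  \<comment> \<open>\<open>2 * C\<close> bounds the coefficients along the unit vectors
    \<open>d i\<close>, and the weights \<open>(1 / 2) ^ i\<close> add up to at most 1.\<close>
  define \<eta>0 where "\<eta>0 = \<eta> / (2 * C)"
  have \<eta>0: "0 < \<eta>0" "2 * C * \<eta>0 = \<eta>" using \<eta> C by (auto simp: \<eta>0_def)
  have tail: "span (y ` {k<..}) \<subseteq> span (b ` {k<..})" for k
  proof (rule span_minimal)
    show "y ` {k<..} \<subseteq> span (b ` {k<..})"
    proof
      fix x assume "x \<in> y ` {k<..}"
      then obtain i where i: "k < i" "x = y i" by auto
      have "k \<le> i - 1" using i(1) by simp
      also have "i - 1 \<le> p (i - 1)" by (rule y(4))
      finally have sub: "{p (i - 1)<..p i} \<subseteq> {k<..}" by auto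
      show "x \<in> span (b ` {k<..})"
        unfolding i(2) by (rule span_image_mono[OF y(1) sub]) (use i(1) in auto)
    qed
  qed simp
  let ?P = "\<lambda>n (d, z, t::nat). d \<in> span (y ` {0<..}) \<and> norm d = 1 \<and> z \<in> Z \<and> norm (z - d) \<le> \<eta>0 * (1 / 2) ^ n"
  let ?Q = "\<lambda>(d, z, t) (d', z', t'). t < t' \<and> d' \<in> span (b ` {t<..t'})"
  have step: "\<exists>x. ?P n x \<and> ?Q (d0, z0, t0) x" for n d0 z0 t0
  proof -
    have "0 < \<eta>0 * (1 / 2) ^ n" using \<eta>0(1) by simp
    then obtain z d where zd: "z \<in> Z" "d \<in> span (y ` {t0<..})" "norm d = 1" "norm (z - d) \<le> \<eta>0 * (1 / 2) ^ n"
      using inf_dim_subspace_near_tail[OF bcy Z] by blast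
    obtain t where t: "t0 \<le> t" "d \<in> span (b ` {t0<..t})"
      using span_tail_bounded[OF subsetD[OF tail zd(2)]] by metis
    have "t \<noteq> t0" using t(2) zd(3) by auto
    moreover have "d \<in> span (y ` {0<..})" by (rule span_image_mono[OF zd(2)]) auto
    ultimately show ?thesis using zd t by (intro exI[of _ "(d, z, t)"]) auto
  qed
  have "\<exists>f. \<forall>n. ?P n (f n) \<and> ?Q (f n) (f (Suc n))"
  proof (rule dependent_nat_choice)
    show "\<exists>x. ?P 0 x" using step[of 0 0 0 0] by blast
    show "\<exists>y. ?P (Suc n) y \<and> ?Q x y" for x n
      using step[of "Suc n" "fst x" "fst (snd x)" "snd (snd x)"] by simp
  qed
  then obtain f where f: "\<forall>n. ?P n (f n) \<and> ?Q (f n) (f (Suc n))" by (rule exE)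
  define d where "d n = fst (f n)" for n
  define z where "z n = fst (snd (f n))" for n
  define r where "r n = snd (snd (f n))" for n
  have P: "d n \<in> span (y ` {0<..})" "norm (d n) = 1" "z n \<in> Z" "norm (z n - d n) \<le> \<eta>0 * (1 / 2) ^ n" for n
    using f[rule_format, of n] by (auto simp: d_def z_def split: prod.splits)
  have Q: "r n < r (Suc n)" "d (Suc n) \<in> span (b ` {r n<..r (Suc n)})" for n
    using f[rule_format, of n] by (auto simp: d_def r_def split: prod.splits)
  have "strict_mono r" using Q(1) by (simp add: strict_mono_Suc_iff)
  then have r: "mono r" "\<And>i. i \<le> r i" by (simp_all add: strict_mono_mono strict_mono_imp_increasing)
  have dspan: "d i \<in> span (b ` {r (i - 1)<..r i})" if "0 < i" for i
    using Q(2)[of "i - 1"] that by simp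
  have dnz: "d i \<noteq> 0" for i using P(2)[of i] by auto
  have bcd: "basis_const C d"
    by (rule asymptotic_const_imp_basis_const[OF asymptotic_const_block[OF asy r dspan dnz]])
  let ?V = "span (d ` {0<..})"
  have "\<exists>w\<in>Z. norm (v - w) \<le> \<eta> * norm v" if v: "v \<in> ?V" for v
  proof -
    obtain c F where F: "finite F" "F \<subseteq> {0<..}" "v = (\<Sum>i\<in>F. c i *\<^sub>R d i)" "\<And>i. i \<notin> F \<Longrightarrow> c i = 0"
      using span_image_explicit[OF v] by metis
    define M where "M = Max (insert 0 F)"
    have FM: "F \<subseteq> {1..M}"
    proof
      fix i assume i: "i \<in> F"
      then have "i \<le> M" unfolding M_def using F(1) by (intro Max_ge) auto
      then show "i \<in> {1..M}" using F(2) i by auto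
    qed
    have vM: "v = (\<Sum>i=1..M. c i *\<^sub>R d i)"
      unfolding F(3) by (rule sum.mono_neutral_left[rotated]) (use FM F(4) in auto)
    have coef: "\<bar>c i\<bar> \<le> 2 * C * norm v" if "i \<in> {1..M}" for i
    proof -
      have "(\<Sum>j=1..i. c j *\<^sub>R d j) = (\<Sum>j=1..i - 1. c j *\<^sub>R d j) + c i *\<^sub>R d i"
        using that by (cases i) auto
      then have "norm (c i *\<^sub>R d i) \<le> norm (\<Sum>j=1..i. c j *\<^sub>R d j) + norm (\<Sum>j=1..i - 1. c j *\<^sub>R d j)"
        by (metis add_diff_cancel_left' norm_triangle_ineq4)
      moreover have "norm (\<Sum>j=1..i. c j *\<^sub>R d j) \<le> C * norm v"
        unfolding vM using that by (intro norm_partial_sum_le[OF bcd]) auto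
      moreover have "norm (\<Sum>j=1..i - 1. c j *\<^sub>R d j) \<le> C * norm v"
        unfolding vM using that by (intro norm_partial_sum_le[OF bcd]) auto
      ultimately show ?thesis using P(2)[of i] by simp
    qed
    define w where "w = (\<Sum>i=1..M. c i *\<^sub>R z i)"
    have "w \<in> Z" unfolding w_def by (intro subspace_sum[OF sub] subspace_scale[OF sub] P(3))
    have "norm (v - w) \<le> (\<Sum>i=1..M. norm (c i *\<^sub>R (d i - z i)))"
      unfolding vM w_def sum_subtractf[symmetric] scaleR_diff_right[symmetric] by (rule norm_sum)
    also have "\<dots> \<le> (\<Sum>i=1..M. 2 * C * norm v * (\<eta>0 * (1 / 2) ^ i))"
    proof (rule sum_mono)
      fix i assume "i \<in> {1..M}"
      then show "norm (c i *\<^sub>R (d i - z i)) \<le> 2 * C * norm v * (\<eta>0 * (1 / 2) ^ i)"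
        unfolding norm_scaleR norm_minus_commute[of "d i"]
        using coef P(4)[of i] C by (intro mult_mono) auto
    qed
    also have "\<dots> = \<eta> * norm v * (\<Sum>i=1..M. (1 / 2) ^ i)"
      unfolding sum_distrib_left \<eta>0(2)[symmetric] by (simp add: mult_ac)
    also have "\<dots> \<le> \<eta> * norm v"
      using mult_left_mono[OF sum_half_powers_le[of M], of "\<eta> * norm v"] \<eta> by simp
    finally show ?thesis using \<open>w \<in> Z\<close> by blast
  qed
  moreover have "?V \<subseteq> span (y ` {0<..})" using P(1) by (intro span_minimal) auto
  moreover have "big_subspace b ?V" by (rule big_subspace_blocks[OF dspan dnz r(2)])
  ultimately show ?thesis by blast
qed

section \<open>Distortion\<close>

lemma equivalent_norm_on_subset:
  assumes "equivalent_norm_on Y N" "X \<subseteq> Y"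
  shows "equivalent_norm_on X N"
proof -
  have "\<exists>a>0. \<exists>b>0. \<forall>x\<in>Y. a * norm x \<le> N x \<and> N x \<le> b * norm x"
    using assms(1) unfolding equivalent_norm_on_def by (elim conjE)
  then have "\<exists>a>0. \<exists>b>0. \<forall>x\<in>X. a * norm x \<le> N x \<and> N x \<le> b * norm x"
    using assms(2) by (meson subsetD)
  moreover have "x \<in> Y" if "x \<in> X" for x using that assms(2) by blast
  ultimately show ?thesis
    using assms(1) unfolding equivalent_norm_on_def by (elim conjE, intro conjI) simp_all
qed

text \<open>Each competing \<open>Z\<close> is replaced by a nearby \<open>V\<close> of finitely
  supported vectors, where both extreme values of the new norm are found. The strict inequality
  \<open>r * \<theta> < 1\<close> absorbs the approximation errors.\<close>

lemma distortion_constant_ge: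
  fixes b :: "nat \<Rightarrow> 'a::real_normed_vector"
  assumes asy: "asymptotic_const C b"
    and y: "\<And>i. 0 < i \<Longrightarrow> y i \<in> span (b ` {p (i - 1)<..p i})" "\<And>i. 0 < i \<Longrightarrow> y i \<noteq> 0"
      "mono p" "\<And>i. i \<le> p i"
    and bad: "\<And>V. big_subspace b V \<Longrightarrow> V \<subseteq> span (y ` {0<..}) \<Longrightarrow>
      \<exists>s t v T. blk b V n s t v T \<and> norm v < \<theta> * T"
    and \<theta>: "0 < \<theta>" and r: "0 < r" "r * \<theta> < 1"
  shows "ereal r \<le> distortion_constant (closed_span y)"
proof -
  have bc: "basis_const C b" using asy by (rule asymptotic_const_imp_basis_const)
  have C: "1 \<le> C" using basis_const_ge_1[OF bc] .
  \<comment> \<open>An empty tuple has \<open>v = 0\<close> and \<open>T = 0\<close>, so it is never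
    bad. With at least one interval the new norm dominates the old one.\<close>
  have "n \<noteq> 0"
  proof
    assume "n = 0"
    obtain s t v T where "blk b (span (y ` {0<..})) n s t v T" "norm v < \<theta> * T"
      using bad[OF big_subspace_blocks[OF y(1,2,4)] order_refl] by metis
    then show False using \<open>n = 0\<close> by (auto elim: blk.cases)
  qed
  then have n: "1 \<le> n" by simp
  define \<beta> where "\<beta> = 2 * C * real n"
  have "1 * 1 \<le> C * real n" using C n by (intro mult_mono) auto
  then have \<beta>: "1 \<le> \<beta>" by (simp add: \<beta>_def)
  define S where "S = span (b ` {0<..})"
  define N where "N = seg_norm b n"
  have "\<exists>N'. equivalent_norm_on UNIV N' \<and> (\<forall>u\<in>S. N' u = N u) \<and> (\<forall>v. N' v \<le> \<beta> * norm v)"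
  proof (rule extend_norm[of S 1 \<beta> N])
    show "subspace S" by (simp add: S_def)
    show "1 * norm u \<le> N u" if "u \<in> S" for u
      using norm_le_seg_norm[OF bc _ n] that unfolding S_def N_def by simp
    show "N u \<le> \<beta> * norm u" if "u \<in> S" for u
      unfolding N_def \<beta>_def using that seg_sum_le[OF bc]
      by (intro seg_norm_leI[OF bc]) (simp add: S_def)
    show "N (u + v) \<le> N u + N v" if "u \<in> S" "v \<in> S" for u v
      unfolding N_def
    proof (rule seg_norm_leI[OF bc])
      fix p :: "nat \<Rightarrow> nat" assume p: "mono p"
      show "seg_sum b n p (u + v) \<le> seg_norm b n u + seg_norm b n v"
        using seg_sum_add[OF bc, of u v n p] seg_sum_le_norm[OF bc _ p, of u n]
          seg_sum_le_norm[OF bc _ p, of v n] that unfolding S_def by linarith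
    qed
    show "N (c *\<^sub>R u) = \<bar>c\<bar> * N u" if u: "u \<in> S" for c u
    proof (rule antisym)
      have le: "N (c *\<^sub>R u) \<le> \<bar>c\<bar> * N u" if u: "u \<in> S" for c u
        unfolding N_def
      proof (rule seg_norm_leI[OF bc])
        fix p :: "nat \<Rightarrow> nat" assume p: "mono p"
        show "seg_sum b n p (c *\<^sub>R u) \<le> \<bar>c\<bar> * seg_norm b n u"
          using seg_sum_scaleR[OF bc, of u n p c] seg_sum_le_norm[OF bc _ p, of u n] u
          unfolding S_def by (simp add: mult_left_mono)
      qed
      show "N (c *\<^sub>R u) \<le> \<bar>c\<bar> * N u" using le[OF u] .
      show "\<bar>c\<bar> * N u \<le> N (c *\<^sub>R u)"
      proof (cases "c = 0")
        case True
        have "norm (0::'a) \<le> N 0"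
          unfolding N_def by (rule norm_le_seg_norm[OF bc _ n]) (simp add: span_zero)
        then show ?thesis using True by simp
      next
        case False
        have "c *\<^sub>R u \<in> S" using u unfolding S_def by (rule span_scale)
        from le[OF this, of "inverse c"] show ?thesis using False by (simp add: field_simps)
      qed
    qed
  qed (use \<beta> in auto)
  then obtain N' where N': "equivalent_norm_on UNIV N'" "\<And>u. u \<in> S \<Longrightarrow> N' u = N u"
    "\<And>v. N' v \<le> \<beta> * norm v" by metis
  have tri: "N' (x + y) \<le> N' x + N' y" and hom: "N' (c *\<^sub>R x) = \<bar>c\<bar> * N' x"
    and nonneg: "0 \<le> N' x" and zero: "N' x = 0 \<longleftrightarrow> x = 0" for x y c
    using N'(1) unfolding equivalent_norm_on_def by auto
  \<comment> \<open>This Lipschitz bound carries values of the norm from \<open>V\<close> over to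
    nearby vectors of \<open>Z\<close>.\<close>
  have lip: "\<bar>N' x - N' y\<bar> \<le> \<beta> * norm (x - y)" for x y
    using tri[of "x - y" y] tri[of "y - x" x] N'(3)[of "x - y"] N'(3)[of "y - x"]
    by (simp add: norm_minus_commute)
  \<comment> \<open>\<open>\<kappa>\<close> solves
    \<open>1 / \<theta> - \<kappa> = r * (1 + \<kappa>)\<close>: it is the error allowed in both the
    large and the small value while their quotient stays at least \<open>r\<close>.\<close>
  define \<kappa> where "\<kappa> = (1 / \<theta> - r) / (1 + r)"
  have "r < 1 / \<theta>" using r(2) \<theta> by (simp add: less_divide_eq)
  then have \<kappa>_pos: "0 < \<kappa>" using r(1) by (simp add: \<kappa>_def)
  have "\<kappa> * (1 + r) = 1 / \<theta> - r" using r(1) by (simp add: \<kappa>_def)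
  then have "1 / \<theta> - \<kappa> = r * (1 + \<kappa>)" by (simp add: algebra_simps)
  note \<kappa> = \<kappa>_pos this
  \<comment> \<open>Normalizing the approximant in \<open>Z\<close> doubles the distance to
    \<open>2 * \<eta>\<close>, which costs at most \<open>\<kappa> / 2\<close>; the bound
    \<open>1 / 2\<close> keeps the approximant nonzero.\<close>
  define \<eta> where "\<eta> = min (1 / 2) (\<kappa> / (4 * \<beta>))"
  have \<eta>: "0 < \<eta>" "\<eta> \<le> 1 / 2" "\<beta> * (2 * \<eta>) \<le> \<kappa> / 2"
    using \<kappa> \<beta> by (auto simp: \<eta>_def min_def field_simps)
  have "ereal r \<le> norm_distortion (closed_span y) N'"
    unfolding norm_distortion_def
  proof (rule INF_greatest)
    fix Z assume "Z \<in> {Z. inf_dim_subspace Z \<and> Z \<subseteq> closed_span y}"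
    then have Z: "inf_dim_subspace Z" "Z \<subseteq> closed_span y" by auto
    then have sub: "subspace Z" unfolding inf_dim_subspace_def by blast
    obtain V where V: "big_subspace b V" "V \<subseteq> span (y ` {0<..})"
      "\<And>v. v \<in> V \<Longrightarrow> \<exists>z\<in>Z. norm (v - z) \<le> \<eta> * norm v"
      using inf_dim_subspace_near_big_subspace[OF asy y Z \<eta>(1)] by metis
    have Vsub: "subspace V" "V \<subseteq> S" using V(1) unfolding big_subspace_def S_def by auto
    have transfer: "\<exists>z\<in>Z. norm z = 1 \<and> \<bar>N' z - N v / norm v\<bar> \<le> \<kappa> / 2" if v: "v \<in> V" "v \<noteq> 0" for v
    proof -
      define v1 where "v1 = (1 / norm v) *\<^sub>R v"
      have v1: "v1 \<in> V" "norm v1 = 1" "N' v1 = N v / norm v"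
        using v Vsub N'(2)[of v] by (auto simp: v1_def subspace_scale hom)
      obtain z0 where z0: "z0 \<in> Z" "norm (v1 - z0) \<le> \<eta>" using V(3)[OF v1(1)] v1(2) by auto
      have nz: "\<bar>norm z0 - 1\<bar> \<le> \<eta>"
        using norm_triangle_ineq3[of v1 z0] z0(2) v1(2) by linarith
      then have pos: "0 < norm z0" using \<eta>(2) by linarith
      define z where "z = (1 / norm z0) *\<^sub>R z0"
      have "norm z = 1" "z \<in> Z" using pos z0(1) sub by (auto simp: z_def subspace_scale)
      have "z0 = norm z0 *\<^sub>R z" using pos by (simp add: z_def)
      then have "z0 - z = (norm z0 - 1) *\<^sub>R z" by (simp add: scaleR_diff_left)
      then have "norm (z0 - z) \<le> \<eta>" using \<open>norm z = 1\<close> nz by simp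
      then have "norm (z - v1) \<le> 2 * \<eta>"
        using norm_triangle_ineq[of "v1 - z0" "z0 - z"] z0(2) by (simp add: norm_minus_commute)
      then have "\<beta> * norm (z - v1) \<le> \<beta> * (2 * \<eta>)" using \<beta> by (intro mult_left_mono) auto
      then have "\<bar>N' z - N' v1\<bar> \<le> \<kappa> / 2" using lip[of z v1] \<eta>(3) by linarith
      then show ?thesis using \<open>norm z = 1\<close> \<open>z \<in> Z\<close> v1(3) by auto
    qed
    obtain x where x: "x \<in> Z" "norm x = 1" "1 / \<theta> - \<kappa> \<le> N' x"
    proof -
      obtain s t v T where v: "blk b V n s t v T" "norm v < \<theta> * T" using bad[OF V(1,2)] by metis
      have "v \<in> V" using blk_in[OF v(1) Vsub(1)] by blast
      have NT: "T \<le> N v" unfolding N_def using blk_le_seg_norm[OF bc v(1)] .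
      have "0 \<le> norm v" by simp
      then have "0 < \<theta> * T" using v(2) by linarith
      then have T: "0 < T" using \<theta> by (simp add: zero_less_mult_iff)
      have "v \<noteq> 0"
      proof
        assume "v = 0"
        then have "N v = 0" using N'(2)[of 0] Vsub \<open>v \<in> V\<close> zero[of 0] by auto
        then show False using T NT by simp
      qed
      have "norm v \<le> \<theta> * N v" using v(2) mult_left_mono[OF NT, of \<theta>] \<theta> by linarith
      then have "1 / \<theta> \<le> N v / norm v" using \<theta> \<open>v \<noteq> 0\<close> by (simp add: field_simps)
      moreover obtain x where x: "x \<in> Z" "norm x = 1" "\<bar>N' x - N v / norm v\<bar> \<le> \<kappa> / 2"
        using transfer[OF \<open>v \<in> V\<close> \<open>v \<noteq> 0\<close>] by metis
      ultimately have "1 / \<theta> - \<kappa> \<le> N' x" using \<kappa>(1) by linarith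
      then show ?thesis using that x(1,2) by blast
    qed
    obtain w where w: "w \<in> Z" "norm w = 1" "N' w \<le> 1 + \<kappa>"
    proof -
      define \<delta> where "\<delta> = \<kappa> / 2"
      have \<delta>: "0 < \<delta>" using \<kappa>(1) by (simp add: \<delta>_def)
      \<comment> \<open>Half of \<open>\<kappa>\<close> is reserved for the transfer to
        \<open>Z\<close>. This \<open>\<epsilon>\<close> gives
        \<open>(1 - \<epsilon>) * (1 + \<delta>) = 1 + \<delta> / 2\<close>, and the last
        \<open>\<delta> / 2\<close> pays for \<open>K\<close> once
        \<open>m > 2 * K / \<delta>\<close>.\<close>
      define \<epsilon> where "\<epsilon> = \<delta> / 2 / (1 + \<delta>)"
      have "1 + \<delta> \<noteq> 0" using \<delta> by simp
      then have "\<epsilon> * (1 + \<delta>) = \<delta> / 2" using \<epsilon>_def by (metis nonzero_eq_divide_eq)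
      then have "(1 - \<epsilon>) * (1 + \<delta>) = 1 + \<delta> / 2" by (simp add: algebra_simps)
      moreover have "0 < \<epsilon>" "\<epsilon> < 1" using \<delta> by (simp_all add: \<epsilon>_def divide_less_eq)
      ultimately have \<epsilon>: "0 < \<epsilon>" "\<epsilon> < 1" "(1 - \<epsilon>) * (1 + \<delta>) = 1 + \<delta> / 2" by auto
      define K where "K = 2 * C * real n * (real n + 1)"
      obtain m :: nat where m: "2 * K / \<delta> < real m" using reals_Archimedean2 by blast
      have "0 \<le> K" using C by (simp add: K_def)
      then have "0 \<le> 2 * K / \<delta>" using \<delta> by simp
      then have m1: "1 \<le> m" using m by linarith
      obtain s t u T where u: "blk b (V \<inter> sphere 0 1) m s t u T" "(1 - \<epsilon>) * m < norm u"
        using ex_almost_isometric_l1_blocks[OF asy V(1) m1 \<epsilon>(1,2)] by metis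
      have "u \<in> V" using blk_in[OF u(1) Vsub(1)] by blast
      have "0 < (1 - \<epsilon>) * m" using \<epsilon> m1 by simp
      then have u0: "0 < norm u" using u(2) by linarith
      have "blk b (sphere 0 1) m s t u T" by (rule blk_mono[OF u(1)]) auto
      then have "N u \<le> m + K"
        unfolding N_def K_def by (rule seg_norm_unit_blocks[OF bc])
      also have "\<dots> \<le> m * (1 + \<delta> / 2)" using m \<delta> by (simp add: field_simps)
      also have "\<dots> = (1 - \<epsilon>) * m * (1 + \<delta>)" using \<epsilon>(3) by (simp add: mult_ac)
      also have "\<dots> \<le> norm u * (1 + \<delta>)" using u(2) \<delta> by (intro mult_right_mono) auto
      finally have "N u / norm u \<le> 1 + \<delta>" using u0 by (simp add: divide_le_eq mult.commute)
      moreover have "u \<noteq> 0" using u0 by auto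
      then obtain w where w: "w \<in> Z" "norm w = 1" "\<bar>N' w - N u / norm u\<bar> \<le> \<kappa> / 2"
        using transfer[OF \<open>u \<in> V\<close>] by metis
      ultimately have "N' w \<le> 1 + \<kappa>" unfolding \<delta>_def by linarith
      then show ?thesis using that w(1,2) by blast
    qed
    have "w \<noteq> 0" using w(2) by auto
    then have "0 < N' w" using nonneg[of w] zero[of w] by simp
    moreover have "r * N' w \<le> N' x"
      using mult_left_mono[OF w(3), of r] r(1) x(3) \<kappa>(2) by linarith
    ultimately have "ereal r \<le> ereal (N' x / N' w)" by (simp add: le_divide_eq)
    then show "ereal r \<le> Sup {ereal (N' x / N' y) |x y. x \<in> Z \<and> y \<in> Z \<and> norm x = 1 \<and> norm y = 1}"
      using x(1,2) w(1,2) by (intro Sup_upper2[of "ereal (N' x / N' w)"]) auto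
  qed
  moreover have "equivalent_norm_on (closed_span y) N'"
    using N'(1) by (rule equivalent_norm_on_subset) simp
  ultimately show ?thesis
    unfolding distortion_constant_def by (intro SUP_upper2[of N']) auto
qed

section \<open>Stabilization\<close>

text \<open>A constant \<open>V\<close> gives a block sequence inside one subspace, a decreasing one
  gives a diagonal sequence; both are used.\<close>

lemma big_subspace_block_sequence:
  fixes V :: "nat \<Rightarrow> 'a::real_normed_vector set"
  assumes "\<And>i. big_subspace b (V i)"
  obtains w r where "mono r" "\<And>i. i \<le> r i"
    "\<And>i. 0 < i \<Longrightarrow> w i \<in> span (b ` {r (i - 1)<..r i})" "\<And>i. 0 < i \<Longrightarrow> w i \<noteq> 0" "\<And>i. w i \<in> V i"
proof -
  let ?P = "\<lambda>n (w, t::nat). w \<in> V n \<and> w \<noteq> 0"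
  let ?Q = "\<lambda>(w, t) (w', t'). t < t' \<and> w' \<in> span (b ` {t<..t'})"
  have step: "\<exists>x. ?P n x \<and> ?Q (w0, t0) x" for n w0 t0
  proof -
    obtain v t where v: "v \<in> V n" "norm v = 1" "v \<in> span (b ` {t0<..t})" "t0 \<le> t"
      using big_subspace_unit[OF assms] by metis
    then have "t \<noteq> t0" "v \<noteq> 0" by auto
    then show ?thesis using v by (intro exI[of _ "(v, t)"]) auto
  qed
  have "\<exists>f. \<forall>n. ?P n (f n) \<and> ?Q (f n) (f (Suc n))"
  proof (rule dependent_nat_choice)
    show "\<exists>x. ?P 0 x" using step[of 0 0 0] by blast
    show "\<exists>y. ?P (Suc n) y \<and> ?Q x y" for x n
      using step[of "Suc n" "fst x" "snd x"] by simp
  qed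
  then obtain f where f: "\<forall>n. ?P n (f n) \<and> ?Q (f n) (f (Suc n))" by (rule exE)
  define w where "w n = fst (f n)" for n
  define r where "r n = snd (f n)" for n
  have P: "w n \<in> V n" "w n \<noteq> 0" for n
    using f[rule_format, of n] by (auto simp: w_def split: prod.splits)
  have Q: "r n < r (Suc n)" "w (Suc n) \<in> span (b ` {r n<..r (Suc n)})" for n
    using f[rule_format, of n] by (auto simp: w_def r_def split: prod.splits)
  have "strict_mono r" using Q(1) by (simp add: strict_mono_Suc_iff)
  then have "mono r" "\<And>i. i \<le> r i" by (simp_all add: strict_mono_mono strict_mono_imp_increasing)
  moreover have "w i \<in> span (b ` {r (i - 1)<..r i})" if "0 < i" for i
    using Q(2)[of "i - 1"] that by simp
  ultimately show ?thesis using that P by blast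
qed

text \<open>The subspaces \<open>V n\<close> decrease and \<open>V k\<close> has good
  \<open>k\<close>-tuples. If \<open>k \<le> s + 1\<close>, blocks of \<open>w\<close> beyond
  \<open>s\<close> involve only \<open>w i\<close> with \<open>i \<ge> k\<close>, all of which lie
  in \<open>V k\<close>.\<close>

lemma diagonal_block_sequence:
  fixes b :: "nat \<Rightarrow> 'a::real_normed_vector"
  assumes "\<And>i. 0 < i \<Longrightarrow> b i \<noteq> 0"
    and refine: "\<And>V n. big_subspace b V \<Longrightarrow> \<exists>V'. big_subspace b V' \<and> V' \<subseteq> V \<and>
      (\<forall>s t v T. blk b V' n s t v T \<longrightarrow> \<theta> * T \<le> norm v)"
  obtains w r where "mono r" "\<And>i. i \<le> r i"
    "\<And>i. 0 < i \<Longrightarrow> w i \<in> span (b ` {r (i - 1)<..r i})" "\<And>i. 0 < i \<Longrightarrow> w i \<noteq> 0"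
    "\<And>k s t v T. blk w UNIV k s t v T \<Longrightarrow> k \<le> s + 1 \<Longrightarrow> \<theta> * T \<le> norm v"
proof -
  let ?P = "\<lambda>n V. big_subspace b V \<and> (\<forall>s t v T. blk b V n s t v T \<longrightarrow> \<theta> * T \<le> norm v)"
  have base: "big_subspace b (span (b ` {0<..}))"
    by (rule big_subspace_blocks[of b b id]) (use assms(1) in \<open>auto intro: span_base\<close>)
  have "\<exists>V. \<forall>n. ?P n (V n) \<and> V (Suc n) \<subseteq> V n"
  proof (rule dependent_nat_choice)
    show "\<exists>V. ?P 0 V" using refine[OF base, of 0] by blast
    show "\<exists>W. ?P (Suc n) W \<and> W \<subseteq> V" if "?P n V" for V n
      using refine[of V "Suc n"] that by blast
  qed
  then obtain V where V: "\<forall>n. ?P n (V n) \<and> V (Suc n) \<subseteq> V n" by (rule exE)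
  have anti: "V j \<subseteq> V i" if "i \<le> j" for i j
    by (rule lift_Suc_antimono_le[OF _ that]) (use V in blast)
  have big: "big_subspace b (V i)" for i using V by blast
  obtain w r where w: "mono r" "\<And>i. i \<le> r i"
    "\<And>i. 0 < i \<Longrightarrow> w i \<in> span (b ` {r (i - 1)<..r i})" "\<And>i. 0 < i \<Longrightarrow> w i \<noteq> 0" "\<And>i. w i \<in> V i"
    using big_subspace_block_sequence[of b V, OF big] by metis
  have "\<theta> * T \<le> norm v" if blk: "blk w UNIV k s t v T" and k: "k \<le> s + 1" for k s t v T
  proof -
    have "w ` {s<..} \<subseteq> V k"
    proof
      fix x assume "x \<in> w ` {s<..}"
      then obtain i where "s < i" "x = w i" by auto
      then show "x \<in> V k" using w(5)[of i] anti[of k i] k by auto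
    qed
    moreover have "subspace (V k)" using big unfolding big_subspace_def by blast
    ultimately have "span (w ` {s<..}) \<inter> UNIV \<subseteq> V k" by (simp add: span_minimal)
    then have "blk b (V k) k (r s) (r t) v T"
      by (intro blk_change_basis[OF blk w(1,3)]) auto
    then show ?thesis using V by blast
  qed
  then show ?thesis using that w by blast
qed

section \<open>The asymptotic inequalities in terms of \<open>blk\<close>\<close>

text \<open>A 1-admissible tuple has at most as many terms as the first index of its support, which
  is the condition \<open>k \<le> s + 1\<close> with \<open>s\<close> just before that
  index.\<close>

lemma delta_one_ge:
  fixes w :: "nat \<Rightarrow> 'a::real_normed_vector"
  assumes uniq: "unique_expansions w" and w1: "w 1 \<noteq> 0" and "0 \<le> c"
    and c: "\<And>k s t v T. blk w UNIV k s t v T \<Longrightarrow> k \<le> s + 1 \<Longrightarrow> c * T \<le> norm v"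
  shows "c \<le> delta A 1 w"
  unfolding delta_def
proof (rule cSup_upper)
  have "c * (\<Sum>i=1..k. norm (y i)) \<le> norm (\<Sum>i=1..k. y i)" if y: "admissible_blocks A 1 w k y" for k y
  proof (cases "k = 0")
    case False
    define F where "F = (\<lambda>i. Min (supp w (y i))) ` {1..k}"
    have F: "F \<in> schreier1" and bl: "blocks_on {1..k} w y"
      using y unfolding admissible_blocks_def F_def schreier_one finite_block_sequence_def by auto
    have yi: "y i \<in> span (w ` {0<..})" "y i \<noteq> 0" if "i \<in> {1..k}" for i
      using bl that unfolding blocks_on_def atLeast_one_eq by auto
    have f: "finite (supp w (y i))" "supp w (y i) \<noteq> {}" "supp w (y i) \<subseteq> {0<..}" if "i \<in> {1..k}" for i
      using supp_span[OF uniq yi(1)[OF that]] supp_nonempty[OF uniq yi[OF that]] by auto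
    have mm: "Min (supp w (y i)) \<le> Max (supp w (y i))" if "i \<in> {1..k}" for i
      using f[OF that] by simp
    have less: "Max (supp w (y i)) < Min (supp w (y j))" if "i \<in> {1..k}" "j \<in> {1..k}" "i < j" for i j
      using bl that unfolding blocks_on_def by blast
    have "inj_on (\<lambda>i. Min (supp w (y i))) {1..k}"
    proof (rule linorder_inj_onI')
      fix i j assume ij: "i \<in> {1..k}" "j \<in> {1..k}" "i < j"
      show "Min (supp w (y i)) \<noteq> Min (supp w (y j))" using mm[OF ij(1)] less[OF ij] by linarith
    qed
    then have "card F = k" unfolding F_def by (simp add: card_image)
    moreover have "Min (supp w (y 1)) \<in> F" using False unfolding F_def by auto
    ultimately have k: "k \<le> Min (supp w (y 1))"
      using F Min_le[of F] unfolding schreier1_def by fastforce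
    have "1 \<in> {1..k}" using False by simp
    from subsetD[OF f(3)[OF this] Min_in[OF f(1,2)[OF this]]] have pos: "0 < Min (supp w (y 1))" by simp
    \<comment> \<open>\<open>p 0\<close> sits just before the support of the first block, so
      \<open>k \<le> Min (supp w (y 1))\<close> becomes \<open>k \<le> p 0 + 1\<close>.\<close>
    define p where "p j = (if j = 0 then Min (supp w (y 1)) - 1 else Max (supp w (y j)))" for j :: nat
    have pj: "p (j - 1) < Min (supp w (y j))" if "j \<in> {1..k}" for j
    proof (cases "j = 1")
      case False
      then have "j - 1 \<in> {1..k}" "j - 1 < j" "j - 1 \<noteq> 0" using that by auto
      then show ?thesis using less[OF _ that] by (simp add: p_def)
    qed (use pos in \<open>simp add: p_def\<close>)
    have "blk w UNIV k (p 0) (p k) (\<Sum>j=1..k. y j) (\<Sum>j=1..k. norm (y j))"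
    proof (rule blk_function)
      fix j assume j: "j \<in> {1..k}"
      show "y j \<in> span (w ` {p (j - 1)<..p j})"
        using j by (intro span_supp[OF uniq yi[OF j] pj[OF j]]) (simp add: p_def)
      show "p (j - 1) \<le> p j" using pj[OF j] mm[OF j] j by (simp add: p_def)
    qed simp
    moreover have "k \<le> p 0 + 1" using k by (simp add: p_def)
    ultimately show ?thesis by (rule c)
  qed simp
  then show "c \<in> {d. 0 \<le> d \<and> (\<forall>k y. admissible_blocks A 1 w k y \<longrightarrow>
      d * (\<Sum>i=1..k. norm (y i)) \<le> norm (\<Sum>i=1..k. y i))}"
    using \<open>0 \<le> c\<close> by blast
  \<comment> \<open>The real supremum needs a bounded set: the one-term tuple \<open>w 1\<close> is
    admissible and forces \<open>d \<le> 1\<close>.\<close>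
  have ws: "w 1 \<in> span (w ` {0<..})" by (intro span_base) auto
  note s = supp_span(1,2)[OF uniq ws] supp_nonempty[OF uniq ws w1]
  have "Min (supp w (w 1)) \<in> supp w (w 1)" using s by (intro Min_in) auto
  then have "1 \<le> Min (supp w (w 1))" using s(1) by fastforce
  then have "admissible_blocks A 1 w 1 (\<lambda>_. w 1)"
    using ws w1 unfolding admissible_blocks_def finite_block_sequence_def blocks_on_def atLeast_one_eq
      schreier_one schreier1_def by simp
  then have "d * norm (w 1) \<le> norm (w 1)" if "\<forall>k y. admissible_blocks A 1 w k y \<longrightarrow>
      d * (\<Sum>i=1..k. norm (y i)) \<le> norm (\<Sum>i=1..k. y i)" for d
    using that[rule_format, of 1 "\<lambda>_. w 1"] by simp
  moreover have "d \<le> 1" if "d * norm (w 1) \<le> norm (w 1)" for d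
    by (rule mult_right_le_imp_le[of _ "norm (w 1)"]) (use that w1 in auto)
  ultimately show "bdd_above {d. 0 \<le> d \<and> (\<forall>k y. admissible_blocks A 1 w k y \<longrightarrow>
      d * (\<Sum>i=1..k. norm (y i)) \<le> norm (\<Sum>i=1..k. y i))}"
    by (intro bdd_aboveI[of _ 1]) blast
qed

text \<open>The nonzero blocks of a tuple supported beyond \<open>s\<close> number at most
  \<open>s + 1\<close>, hence at most the first index of their support.\<close>

lemma asymptotic_l1_blk:
  assumes "unique_expansions e" "asymptotic_l1 e"
  obtains C where "0 < C" "\<And>k s t v T. blk e UNIV k s t v T \<Longrightarrow> k \<le> s + 1 \<Longrightarrow> T \<le> C * norm v"
proof -
  obtain C where C: "0 < C" "\<And>n x. 1 \<le> n \<Longrightarrow> finite_block_sequence e n x \<Longrightarrow> n \<le> Min (supp e (x 1)) \<Longrightarrow>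
      (1 / C) * (\<Sum>i=1..n. norm (x i)) \<le> norm (\<Sum>i=1..n. x i)"
    using assms(2) unfolding asymptotic_l1_def by blast
  have "T \<le> C * norm v" if blk: "blk e UNIV k s t v T" and k: "k \<le> s + 1" for k s t v T
    using blk
  proof (cases rule: blk_nonzero_function)
    case (1 l y p)
    show ?thesis
    proof (cases "l = 0")
      case False
      have "finite_block_sequence e l y"
        unfolding finite_block_sequence_def
        by (rule blocks_onI[where p = p]) (use assms(1) 1 in auto)
      moreover have "p 0 < Min (supp e (y 1))"
        using 1(5)[of 1] False by (intro supp_greaterThanAtMost(1)[OF assms(1)]) auto
      then have "l \<le> Min (supp e (y 1))" using 1(1,3) k by simp
      ultimately have "(1 / C) * T \<le> norm v" using C(2)[of l y] False 1(6,7) by simp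
      then show ?thesis using C(1) by (simp add: divide_le_eq mult.commute)
    qed (use 1 in simp)
  qed simp
  then show ?thesis using that C(1) by blast
qed

section \<open>Choosing the tail and the block subspace to be distorted\<close>

theorem proposition6p12:
  fixes e :: "nat \<Rightarrow> 'a::banach"
    and A :: "omega1 \<Rightarrow> nat \<Rightarrow> omega1"
  assumes "ladder_system A"
    and "schauder_basis e UNIV"
    and "asymptotic_l1 e"
  shows "(SUP Y \<in> {Y. block_subspace e Y}. distortion_constant Y)
       \<ge> (SUP \<gamma> \<in> Delta_set A e. inverse (ereal (\<gamma> 1)))"
proof (rule SUP_least)
  fix \<gamma> assume "\<gamma> \<in> Delta_set A e"
  then obtain x \<epsilon> where x: "block_basis e x" and \<epsilon>: "\<epsilon> \<longlonglongrightarrow> 0"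
    and stab: "\<forall>\<alpha>. \<exists>m\<ge>1. \<forall>n\<ge>m. \<forall>y. block_basis (tail_seq n x) y \<longrightarrow> \<bar>delta A \<alpha> y - \<gamma> \<alpha>\<bar> < \<epsilon> n"
    unfolding Delta_set_def Delta_stabilizes_def by blast
  obtain m where m: "\<And>n y. m \<le> n \<Longrightarrow> block_basis (tail_seq n x) y \<Longrightarrow> \<bar>delta A 1 y - \<gamma> 1\<bar> < \<epsilon> n"
    using stab by metis
  have uniq: "unique_expansions e"
    using assms(2) unfolding schauder_basis_def unique_expansions_def by blast
  obtain C where C: "0 < C" "\<And>k s t v T. blk e UNIV k s t v T \<Longrightarrow> k \<le> s + 1 \<Longrightarrow> T \<le> C * norm v"
    using asymptotic_l1_blk[OF uniq assms(3)] by metis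
  obtain p where p: "strict_mono p" "\<And>i. 0 < i \<Longrightarrow> x i \<in> span (e ` {p (i - 1)<..p i})"
    using block_basisE[OF uniq x] by metis
  have xnz: "x i \<noteq> 0" if "0 < i" for i
    using x that unfolding block_basis_def blocks_on_def by simp
  define q where "q n i = p (n + i - 1)" for n i
  have q: "mono (q n)" "i + n \<le> q n i + 1" for n i
  proof -
    show "mono (q n)" unfolding q_def mono_def using strict_mono_mono[OF p(1)] by (auto intro: monoD)
    show "i + n \<le> q n i + 1" unfolding q_def using strict_mono_imp_increasing[OF p(1), of "n + i - 1"] by simp
  qed
  have tail: "tail_seq n x i \<in> span (e ` {q n (i - 1)<..q n i})" if "2 \<le> n" "0 < i" for n i
    using p(2)[of "n + i - 1"] that by (simp add: tail_seq_def q_def)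
  have tail_nz: "tail_seq n x i \<noteq> 0" if "2 \<le> n" "0 < i" for n i
    using xnz that by (simp add: tail_seq_def)
  have asy: "asymptotic_const C (tail_seq n x)" if n: "2 \<le> n" for n
    unfolding asymptotic_const_def
  proof (intro conjI allI impI)
    fix k s t v T assume blk: "blk (tail_seq n x) UNIV k s t v T" and k: "k \<le> s + 2"
    have "blk e UNIV k (q n s) (q n t) v T"
      by (rule blk_change_basis[OF blk q(1) tail[OF n]]) auto
    \<comment> \<open>Dropping at least one term of \<open>x\<close> pays for the additional block:
      \<open>s + 2 \<le> s + n \<le> q n s + 1\<close>.\<close>
    moreover have "k \<le> q n s + 1" using q(2)[of s n] n k by linarith
    ultimately show "T \<le> C * norm v" by (rule C(2))
  qed (use tail_nz n in auto)
  \<comment> \<open>Far tails have \<open>delta A 1\<close> at least \<open>1 / C\<close>, so in the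
    limit \<open>\<gamma> 1 \<ge> 1 / C > 0\<close> and the inverse is a positive real.\<close>
  have "eventually (\<lambda>n. 1 / C \<le> \<gamma> 1 + \<epsilon> n) sequentially"
  proof (rule eventually_sequentiallyI)
    fix n assume n: "max m 2 \<le> n"
    let ?b = "tail_seq n x"
    have a: "asymptotic_const C ?b" using asy n by simp
    have u: "unique_expansions ?b"
      by (rule unique_expansions_basis_const[OF asymptotic_const_imp_basis_const[OF a]])
    have "block_basis ?b ?b"
      by (rule block_basisI[OF u, of id]) (use tail_nz n in \<open>auto intro: span_base simp: mono_def\<close>)
    moreover have "1 / C \<le> delta A 1 ?b"
    proof (rule delta_one_ge[OF u])
      show "?b 1 \<noteq> 0" using tail_nz n by simp
      fix k s t v T assume "blk ?b UNIV k s t v T" "k \<le> s + 1"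
      then have "T \<le> C * norm v" using a unfolding asymptotic_const_def by (meson add_left_mono le_trans one_le_numeral)
      then show "1 / C * T \<le> norm v" using C(1) by (simp add: divide_le_eq mult.commute)
    qed (use C(1) in simp)
    ultimately show "1 / C \<le> \<gamma> 1 + \<epsilon> n" using m[of n ?b] n by fastforce
  qed
  then have "1 / C \<le> \<gamma> 1 + 0"
    by (intro tendsto_lowerbound[OF tendsto_add[OF tendsto_const \<epsilon>]]) auto
  then have \<gamma>: "0 < \<gamma> 1" using C(1) by (simp add: less_le_trans[of 0 "1 / C"])
  show "inverse (ereal (\<gamma> 1)) \<le> (SUP Y \<in> {Y. block_subspace e Y}. distortion_constant Y)"
  proof (rule dense_le_bounded)
    show "0 < inverse (ereal (\<gamma> 1))" using \<gamma> by simp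
    fix R assume R: "0 < R" "R < inverse (ereal (\<gamma> 1))"
    then obtain r where r: "R = ereal r" "0 < r" "r < 1 / \<gamma> 1"
      using \<gamma> by (cases R) (auto simp: inverse_eq_divide)
    \<comment> \<open>The midpoint lies strictly above \<open>\<gamma> 1\<close>, which yields the
      contradiction with stabilization, and strictly below \<open>1 / r\<close>, which yields
      \<open>r * \<theta> < 1\<close>.\<close>
    define \<theta> where "\<theta> = (\<gamma> 1 + 1 / r) / 2"
    have "\<gamma> 1 < 1 / r" using r \<gamma> by (simp add: field_simps)
    then have \<theta>: "\<gamma> 1 < \<theta>" "\<theta> < 1 / r" "0 < \<theta>" using \<gamma> by (auto simp: \<theta>_def)
    have r\<theta>: "r * \<theta> < 1" using \<theta>(2) r(2) by (simp add: field_simps)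
    have "eventually (\<lambda>n. \<epsilon> n < \<theta> - \<gamma> 1) sequentially"
      using \<epsilon> \<theta>(1) by (intro order_tendstoD(2)) auto
    then obtain n0 where n0: "\<And>n. n0 \<le> n \<Longrightarrow> \<epsilon> n < \<theta> - \<gamma> 1"
      unfolding eventually_sequentially by blast
    define n where "n = max n0 (max m 2)"
    have n: "n0 \<le> n" "m \<le> n" "2 \<le> n" by (auto simp: n_def)
    define b where "b = tail_seq n x"
    have asyb: "asymptotic_const C b" unfolding b_def using asy n(3) .
    have bnz: "\<And>i. 0 < i \<Longrightarrow> b i \<noteq> 0" unfolding b_def using tail_nz n(3) by blast
    have "\<exists>V k. big_subspace b V \<and> (\<forall>V'. big_subspace b V' \<and> V' \<subseteq> V \<longrightarrow>
        (\<exists>s t v T. blk b V' k s t v T \<and> norm v < \<theta> * T))"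
    proof (rule ccontr)
      assume neg: "\<not> ?thesis"
      have refine: "\<exists>V'. big_subspace b V' \<and> V' \<subseteq> V \<and> (\<forall>s t v T. blk b V' k s t v T \<longrightarrow> \<theta> * T \<le> norm v)"
        if "big_subspace b V" for V k
        using neg that not_le by metis
      obtain w r where w: "mono r" "\<And>i. i \<le> r i"
        "\<And>i. 0 < i \<Longrightarrow> w i \<in> span (b ` {r (i - 1)<..r i})" "\<And>i. 0 < i \<Longrightarrow> w i \<noteq> 0"
        "\<And>k s t v T. blk w UNIV k s t v T \<Longrightarrow> k \<le> s + 1 \<Longrightarrow> \<theta> * T \<le> norm v"
        using diagonal_block_sequence[OF bnz refine] by metis
      have "block_basis b w"
        by (rule block_basisI[OF unique_expansions_basis_const[OF asymptotic_const_imp_basis_const[OF asyb]] w(1,3,4)])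
      moreover have "unique_expansions w"
        by (rule unique_expansions_basis_const[OF asymptotic_const_imp_basis_const[OF
            asymptotic_const_block[OF asyb w(1-4)]]])
      then have "\<theta> \<le> delta A 1 w"
        by (rule delta_one_ge) (use w(4,5) \<theta>(3) in auto)
      \<comment> \<open>Stabilization gives
        \<open>delta A 1 w < \<gamma> 1 + \<epsilon> n < \<theta>\<close>.\<close>
      ultimately show False using m[OF n(2), of w] n0[OF n(1)] unfolding b_def by linarith
    qed
    then obtain V k where V: "big_subspace b V" "\<And>V'. big_subspace b V' \<Longrightarrow> V' \<subseteq> V \<Longrightarrow>
        \<exists>s t v T. blk b V' k s t v T \<and> norm v < \<theta> * T" by metis
    \<comment> \<open>Taking the blocks inside \<open>V\<close> ensures that every big subspace of
      the span of \<open>y\<close> is contained in \<open>V\<close> and so has a bad tuple.\<close>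
    obtain y t where y: "mono t" "\<And>i. i \<le> t i"
      "\<And>i. 0 < i \<Longrightarrow> y i \<in> span (b ` {t (i - 1)<..t i})" "\<And>i. 0 < i \<Longrightarrow> y i \<noteq> 0" "\<And>i. y i \<in> V"
      using big_subspace_block_sequence[of b "\<lambda>_. V"] V(1) by metis
    have "subspace V" using V(1) unfolding big_subspace_def by blast
    then have yV: "span (y ` {0<..}) \<subseteq> V" using y(5) by (intro span_minimal) auto
    have "ereal r \<le> distortion_constant (closed_span y)"
      by (rule distortion_constant_ge[OF asyb y(3,4,1,2) V(2) \<theta>(3) r(2) r\<theta>]) (use yV in auto)
    \<comment> \<open>Blocks of the tail are blocks of \<open>e\<close> for the composed
      breakpoints, so the closed span of \<open>y\<close> is a block subspace of
      \<open>e\<close>.\<close>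
    moreover have "y i \<in> span (e ` {q n (t (i - 1))<..q n (t i)})" if "0 < i" for i
    proof -
      have "blk b UNIV 1 (t (i - 1)) (t i) (y i) (norm (y i))"
        using y(3)[OF that] monoD[OF y(1)] by (intro blk_single) auto
      then have "blk e UNIV 1 (q n (t (i - 1))) (q n (t i)) (y i) (norm (y i))"
        by (rule blk_change_basis) (use q(1) tail[OF n(3)] in \<open>auto simp: b_def\<close>)
      then show ?thesis by (rule blk_span)
    qed
    then have "block_basis e y"
      by (intro block_basisI[OF uniq, of "\<lambda>i. q n (t i)"] y(4) monoI monoD[OF q(1)] monoD[OF y(1)])
    then have "block_subspace e (closed_span y)" unfolding block_subspace_def by blast
    ultimately show "R \<le> (SUP Y \<in> {Y. block_subspace e Y}. distortion_constant Y)"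
      unfolding r(1) by (intro SUP_upper2[of "closed_span y"]) auto
  qed
qed

end
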